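(* Let $Y$ be a connected strongly regular graph with parameters $(n,k,a,c)$, and let $Y^f$ be a cyclic 2ev-cover of $Y$. Let $\phi$ be a non-trivial irreducible representation of $\langle f\rangle$, let $S=A(Y)^{\phi(f)}$, and let $x^2-\lambda x-\mu$ be the minimal polynomial of $S$. Then $Y^f$ is distance-regular if and only if $a=\lambda$.
   Context: All graphs are finite, simple and undirected; the base graph $Y=(V,E)$ is connected. Covers: let $G$ be a permutation group on $R=\{1,\dots,r\}$. A symmetric arc function is a function $f:V\times V\to G\cup\{0\}$ such that $f(u,v)=0$ if and only if $\{u,v\}\notin E$, and $f(u,v)=f(v,u)^{-1}$ whenever $f(u,v)\in G$. The cover $Y^f$ (of index $r$, or $r$-fold) is the graph with vertex set $V\times R$ in which $(v,j)$ is adjacent to $(u,k)$ exactly when $v$ is adjacent to $u$ in $Y$ and $f(u,v)j=k$. The function $f$ is normalized if $f(u,v)=\mathrm{id}$ for all edges $\{u,v\}$ of some spanning tree of $Y$. Denote by $\langle f\rangle$ the subgroup of $\mathrm{Sym}(r)$ generated by the (non-zero) values of $f$. Standing assumptions: $f$ is normalized and $\langle f\rangle$ acts regularly (i.e. simply transitively) on $\{1,\dots,r\}$. The cover is called cyclic if $\langle f\rangle$ is a cyclic group. Two-eigenvalue cover (2ev-cover): $\mathrm{Spec}(A)$ denotes the spectrum of $A$ as a multiset, and $A(\cdot)$ the adjacency matrix. One has $\mathrm{Spec}(A(Y))\subseteq\mathrm{Spec}(A(Y^f))$ as multisets, and $Y^f$ is a 2ev-cover of $Y$ if the multiset difference $\mathrm{Spec}(A(Y^f))\setminus\mathrm{Spec}(A(Y))$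 has exactly two distinct elements. Representations are over $\mathbb{C}$. For a representation $\phi$ of $\langle f\rangle$ of degree $d$, $A(Y)^{\phi(f)}$ is the matrix obtained from $A(Y)$ by replacing each non-zero entry $A(Y)_{u,v}$ with the matrix $\phi(f(u,v))$ and each zero entry with the $d\times d$ zero matrix (for $\langle f\rangle$ cyclic and $\phi$ irreducible, $d=1$). Distance-regular has its standard meaning: a connected graph of diameter $d$ such that for vertices $v,w$ at distance $i$, the numbers of neighbours of $w$ at distance $i+1$, respectively $i-1$, from $v$ depend only on $i$. A strongly regular graph is a distance-regular graph of diameter $2$; its parameters $(n,k,a,c)$ are the number of vertices $n$, the valency $k$, the number $a$ of common neighbours of two adjacent vertices, and the number $c$ of common neighbours of two distinct non-adjacent vertices. *)

theory Defs
  imports "HOL-Analysis.Analysis" "HOL-Algebra.Elementary_Groups" "HOL-Algebra.Bij"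
begin

text \<open>A finite graph is given by its adjacency relation on a finite vertex type; all elements of the
  type are vertices. The \<open>r\<close> fibre labels are the elements of a finite type \<open>'r\<close>.\<close>

definition simple_graph :: "('v \<Rightarrow> 'v \<Rightarrow> bool) \<Rightarrow> bool" where
  "simple_graph E \<longleftrightarrow> symp E \<and> irreflp E"

definition connected_graph :: "('v \<Rightarrow> 'v \<Rightarrow> bool) \<Rightarrow> bool" where
  "connected_graph E \<longleftrightarrow> (\<forall>u v. E\<^sup>*\<^sup>* u v)"

text \<open>\<open>(E ^^ m) u v\<close> says that there is a walk of length \<open>m\<close> from \<open>u\<close> to \<open>v\<close>. The value of
  \<open>gdist\<close> is meaningful only for vertices in the same component.\<close>

definition gdist :: "('v \<Rightarrow> 'v \<Rightarrow> bool) \<Rightarrow> 'v \<Rightarrow> 'v \<Rightarrow> nat" where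
  "gdist E u v = (LEAST m. (E ^^ m) u v)"

definition gdiameter :: "('v::finite \<Rightarrow> 'v \<Rightarrow> bool) \<Rightarrow> nat" where
  "gdiameter E = Max (range (\<lambda>(u, v). gdist E u v))"

definition distance_regular :: "('v::finite \<Rightarrow> 'v \<Rightarrow> bool) \<Rightarrow> bool" where
  "distance_regular E \<longleftrightarrow> simple_graph E \<and> connected_graph E \<and>
     (\<exists>b c :: nat \<Rightarrow> nat. \<forall>v w.
        card {x. E w x \<and> gdist E v x = gdist E v w + 1} = b (gdist E v w) \<and>
        card {x. E w x \<and> gdist E v x + 1 = gdist E v w} = c (gdist E v w))"

definition strongly_regular ::
    "('v::finite \<Rightarrow> 'v \<Rightarrow> bool) \<Rightarrow> nat \<Rightarrow> nat \<Rightarrow> nat \<Rightarrow> nat \<Rightarrow> bool" where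
  "strongly_regular E n k a c \<longleftrightarrow> distance_regular E \<and> gdiameter E = 2 \<and>
     CARD('v) = n \<and>
     (\<forall>u. card {x. E u x} = k) \<and>
     (\<forall>u v. E u v \<longrightarrow> card {x. E u x \<and> E v x} = a) \<and>
     (\<forall>u v. u \<noteq> v \<and> \<not> E u v \<longrightarrow> card {x. E u x \<and> E v x} = c)"

definition has_cycle :: "('v \<Rightarrow> 'v \<Rightarrow> bool) \<Rightarrow> bool" where
  "has_cycle T \<longleftrightarrow> (\<exists>xs. length xs \<ge> 3 \<and> distinct xs \<and>
     (\<forall>i < length xs. T (xs ! i) (xs ! (Suc i mod length xs))))"

definition spanning_tree :: "('v \<Rightarrow> 'v \<Rightarrow> bool) \<Rightarrow> ('v \<Rightarrow> 'v \<Rightarrow> bool) \<Rightarrow> bool" where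
  "spanning_tree T E \<longleftrightarrow> simple_graph T \<and> T \<le> E \<and> connected_graph T \<and> \<not> has_cycle T"


text \<open>The value \<open>None\<close> of an arc function stands for the symbol \<open>0\<close> adjoined to \<open>G\<close>.\<close>

type_synonym ('v, 'r) arc_fun = "'v \<Rightarrow> 'v \<Rightarrow> ('r \<Rightarrow> 'r) option"

abbreviation Sym :: "('r \<Rightarrow> 'r) monoid" where
  "Sym \<equiv> BijGroup UNIV"

definition symmetric_arc_function ::
    "('v \<Rightarrow> 'v \<Rightarrow> bool) \<Rightarrow> ('r \<Rightarrow> 'r) set \<Rightarrow> ('v, 'r) arc_fun \<Rightarrow> bool" where
  "symmetric_arc_function E G f \<longleftrightarrow>
     (\<forall>u v g. f u v = Some g \<longrightarrow> g \<in> G) \<and>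
     (\<forall>u v. f u v = None \<longleftrightarrow> \<not> E u v) \<and>
     (\<forall>u v g. f u v = Some g \<longrightarrow> (\<exists>h. f v u = Some h \<and> g = inv\<^bsub>Sym\<^esub> h))"

definition normalized :: "('v \<Rightarrow> 'v \<Rightarrow> bool) \<Rightarrow> ('v, 'r) arc_fun \<Rightarrow> bool" where
  "normalized E f \<longleftrightarrow> (\<exists>T. spanning_tree T E \<and> (\<forall>u v. T u v \<longrightarrow> f u v = Some id))"

definition arc_group :: "('v, 'r) arc_fun \<Rightarrow> ('r \<Rightarrow> 'r) monoid" where
  "arc_group f = subgroup_generated Sym {g. \<exists>u v. f u v = Some g}"

definition acts_regularly :: "('r \<Rightarrow> 'r) monoid \<Rightarrow> bool" where
  "acts_regularly H \<longleftrightarrow> (\<forall>i j. \<exists>!g. g \<in> carrier H \<and> g i = j)"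

definition cover :: "('v \<Rightarrow> 'v \<Rightarrow> bool) \<Rightarrow> ('v, 'r) arc_fun \<Rightarrow> 'v \<times> 'r \<Rightarrow> 'v \<times> 'r \<Rightarrow> bool" where
  "cover E f = (\<lambda>(v, j) (u, k). E v u \<and> (\<exists>g. f u v = Some g \<and> g j = k))"


definition adj_matrix :: "('v::finite \<Rightarrow> 'v \<Rightarrow> bool) \<Rightarrow> complex^'v^'v" where
  "adj_matrix E = (\<chi> u v. if E u v then 1 else 0)"

definition charpoly :: "complex^'n^'n \<Rightarrow> complex poly" where
  "charpoly A = det (\<chi> i j. (if i = j then [:0, 1:] else 0) - [:A $ i $ j:])"

definition Spec :: "complex^'n^'n \<Rightarrow> complex multiset" where
  "Spec A = proots (charpoly A)"

definition two_ev_cover ::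
    "('v::finite \<Rightarrow> 'v \<Rightarrow> bool) \<Rightarrow> ('v, 'r::finite) arc_fun \<Rightarrow> bool" where
  "two_ev_cover E f \<longleftrightarrow>
     card (set_mset (Spec (adj_matrix (cover E f)) - Spec (adj_matrix E))) = 2"

definition matrix_poly :: "complex poly \<Rightarrow> complex^'n^'n \<Rightarrow> complex^'n^'n" where
  "matrix_poly p A = (\<Sum>i\<le>degree p. mat (coeff p i) ** (((**) A ^^ i) (mat 1)))"

definition is_minimal_polynomial :: "complex poly \<Rightarrow> complex^'n^'n \<Rightarrow> bool" where
  "is_minimal_polynomial p A \<longleftrightarrow> lead_coeff p = 1 \<and> matrix_poly p A = 0 \<and>
     (\<forall>q. q \<noteq> 0 \<and> matrix_poly q A = 0 \<longrightarrow> degree p \<le> degree q)"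


definition GL :: "(complex^'d^'d) monoid" where
  "GL = \<lparr>carrier = {A. invertible A}, mult = (**), one = mat 1\<rparr>"

text \<open>A representation of degree \<open>d\<close> over the complex numbers is an element of \<open>hom H GL\<close>, where
  \<open>d\<close> is the cardinality of the index type \<open>'d\<close> and is thus automatically positive.\<close>

definition irreducible_rep :: "('g, 'm) monoid_scheme \<Rightarrow> ('g \<Rightarrow> complex^'d^'d) \<Rightarrow> bool" where
  "irreducible_rep H \<phi> \<longleftrightarrow> \<phi> \<in> hom H GL \<and>
     (\<forall>W. vec.subspace W \<and> (\<forall>g \<in> carrier H. \<forall>w \<in> W. \<phi> g *v w \<in> W) \<longrightarrow> W = {0} \<or> W = UNIV)"

definition nontrivial_rep :: "('g, 'm) monoid_scheme \<Rightarrow> ('g \<Rightarrow> complex^'d^'d) \<Rightarrow> bool" where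
  "nontrivial_rep H \<phi> \<longleftrightarrow> (\<exists>g \<in> carrier H. \<phi> g \<noteq> mat 1)"

text \<open>The block matrix whose \<open>(u, v)\<close> block is \<open>\<phi> (f u v)\<close> on arcs and zero elsewhere; the second
  components of the indices are the positions inside a block.\<close>

definition rep_matrix ::
    "('v::finite \<Rightarrow> 'v \<Rightarrow> bool) \<Rightarrow> ('v, 'r) arc_fun \<Rightarrow> (('r \<Rightarrow> 'r) \<Rightarrow> complex^'d^'d) \<Rightarrow>
      complex^('v \<times> 'd::finite)^('v \<times> 'd)" where
  "rep_matrix E f \<phi> = (\<chi> p q. if adj_matrix E $ fst p $ fst q \<noteq> 0
     then \<phi> (the (f (fst p) (fst q))) $ snd p $ snd q else 0)"

end

theory Submission
  imports Defs "HOL-Computational_Algebra.Fundamental_Theorem_Algebra"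
begin

text \<open>Let \<open>A\<close> be the adjacency matrix of the cover, \<open>B\<close> that of \<open>Y\<close>, and \<open>W\<close> the space of vectors whose
  sum over every fibre is zero. The vectors constant on fibres form an \<open>A\<close>-invariant complement of
  \<open>W\<close> on which \<open>A\<close> acts as \<open>B\<close>, so the extra spectrum is that of \<open>A\<close> on \<open>W\<close>. As \<open>A\<close> is real
  symmetric, having exactly two extra eigenvalues \<open>\<theta>\<close>, \<open>\<tau>\<close> means that \<open>(A - \<theta>)(A - \<tau>)\<close> vanishes on \<open>W\<close>,
  that is, its entries are constant along fibres. With \<open>s = \<theta> + \<tau>\<close> this determines the number of common
  neighbours of any two vertices of the cover: none for two vertices in one fibre, \<open>c / r\<close> over
  non-adjacent vertices of \<open>Y\<close>, and \<open>(a - s) / r + s\<close> or \<open>(a - s) / r\<close> over an edge of \<open>Y\<close>, depending on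
  whether the vertices are adjacent. Summing \<open>\<phi>\<close> against these counts, and using \<open>\<Sum>g. \<phi> g = 0\<close>, gives
  \<open>S\<^sup>2 = s S + k\<close>, whence \<open>\<lambda> = s\<close>.

  If \<open>a = \<lambda>\<close>, non-adjacent vertices over an edge have no common neighbour, and all distances
  (at most \<open>4\<close>) and intersection numbers can be read off. If \<open>a \<noteq> \<lambda>\<close>, such vertices are at distance \<open>2\<close>, as
  are vertices over a non-edge; but the former have a neighbour at distance \<open>3\<close> (in the fibre of the
  first vertex) and the latter do not, so \<open>b\<^sub>2\<close> is not well defined.\<close>

section \<open>Splitting off the base spectrum\<close>

text \<open>In the Leibniz expansion a permutation moving some \<open>i\<close> outside
  \<open>range h\<close> picks an off-diagonal entry, hence 0, of the identity column
  \<open>i\<close>. The remaining permutations live on \<open>range h\<close> and correspond to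
  permutations of \<open>'m\<close>.\<close>

lemma det_block_identity_columns:
  fixes M :: "'a::comm_ring_1^'n^'n" and B :: "'a^'m^'m" and h :: "'m \<Rightarrow> 'n"
  assumes h: "inj h"
    and B: "\<And>u v. M $ h u $ h v = B $ u $ v"
    and I: "\<And>p q. q \<notin> range h \<Longrightarrow> M $ p $ q = (if p = q then 1 else 0)"
  shows "det M = det B"
proof -
  let ?t = "\<lambda>p. of_int (sign p) * prod (\<lambda>i. M$i$p i) UNIV"
  have zero: "?t p = 0" if p: "p permutes UNIV" and np: "\<not> p permutes (range h)" for p
  proof -
    obtain i where i: "i \<notin> range h" "p i \<noteq> i"
      using permutes_superset[OF p, of "range h"] np by blast
    obtain l where l: "p l = i"
      using permutes_surj[OF p] by (metis surjD)
    have "l \<noteq> i" using i l by auto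
    then have "M $ l $ p l = 0" using I[OF i(1), of l] l by simp
    then have "prod (\<lambda>i. M$i$p i) UNIV = 0"
      by (intro prod_zero) auto
    then show ?thesis by simp
  qed
  have "det M = (\<Sum>p | p permutes (range h). ?t p)"
    unfolding det_def
  proof (rule sum.mono_neutral_right)
    show "{p. p permutes (range h)} \<subseteq> {p. p permutes UNIV}"
      by (auto intro: permutes_subset)
  qed (use zero in auto)
  also have "\<dots> = (\<Sum>p | p permutes (UNIV :: 'm set). ?t (map_permutation UNIV h p))"
  proof (rule sum.reindex_bij_betw[symmetric])
    have "map_permutation UNIV h = (\<lambda>\<pi> x. if x \<in> range h then h (\<pi> (inv_into UNIV h x)) else x)"
      by (auto simp: fun_eq_iff map_permutation_def restrict_id_def)
    then show "bij_betw (map_permutation UNIV h) {p. p permutes UNIV} {p. p permutes range h}"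
      using bij_betw_permutations[OF inj_on_imp_bij_betw[OF h]] by simp
  qed
  also have "\<dots> = (\<Sum>p | p permutes (UNIV :: 'm set). of_int (sign p) * prod (\<lambda>i. B$i$p i) UNIV)"
  proof (rule sum.cong)
    fix p assume "p \<in> {p. p permutes (UNIV :: 'm set)}"
    then have p: "p permutes UNIV" by simp
    let ?p = "map_permutation UNIV h p"
    have pp: "?p permutes range h" using p h by (intro map_permutation_permutes) (auto simp: bij_betw_def)
    have "prod (\<lambda>i. M$i$?p i) UNIV = prod (\<lambda>i. M$i$?p i) (range h)"
    proof (rule prod.mono_neutral_right)
      show "\<forall>i\<in>UNIV - range h. M $ i $ ?p i = 1"
      proof
        fix i assume "i \<in> UNIV - range h"
        then have "i \<notin> range h" by simp
        with pp have "?p i = i" by (simp add: permutes_not_in)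
        with I[of i i] \<open>i \<notin> range h\<close> show "M $ i $ ?p i = 1" by simp
      qed
    qed auto
    also have "\<dots> = prod (\<lambda>i. B$i$p i) UNIV"
      by (subst prod.reindex[OF h]) (simp add: map_permutation_apply h B)
    finally show "?t ?p = of_int (sign p) * prod (\<lambda>i. B$i$p i) UNIV"
      using p h by (simp add: sign_map_permutation)
  qed simp
  finally show ?thesis by (simp add: det_def)
qed

text \<open>The idempotent \<open>P\<close> projecting onto the vectors constant on fibres, along
  those vanishing on the layer \<open>i0\<close>. Its entries lie in any commutative ring, so that
  it can also multiply polynomial matrices.\<close>

definition fibre_copy :: "'r \<Rightarrow> 'a::comm_ring_1^('v::finite \<times> 'r::finite)^('v \<times> 'r)" where
  "fibre_copy i0 = (\<chi> p q. if q = (fst p, i0) then 1 else 0)"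

lemma fibre_copy_nth: "fibre_copy i0 $ p $ q = (if q = (fst p, i0) then 1 else 0)"
  by (simp add: fibre_copy_def)

lemma fibre_copy_mult:
  "(fibre_copy i0 ** X) $ p $ q = X $ (fst p, i0) $ q"
  by (simp add: fibre_copy_def matrix_matrix_mult_def if_distrib[of "\<lambda>x. x * _"] cong: if_cong)

lemma fibre_copy_vec:
  "(fibre_copy i0 *v x) $ p = x $ (fst p, i0)"
  by (simp add: fibre_copy_def matrix_vector_mult_def if_distrib[of "\<lambda>x. x * _"] cong: if_cong)

lemma sum_pair_UNIV:
  "(\<Sum>p\<in>UNIV. g p) = (\<Sum>u\<in>UNIV. \<Sum>i\<in>UNIV. g (u, i))"
  by (simp add: UNIV_Times_UNIV[symmetric] sum.cartesian_product del: UNIV_Times_UNIV)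

lemma mult_fibre_copy:
  "(X ** fibre_copy i0) $ p $ (v, i) = (if i = i0 then \<Sum>l\<in>UNIV. X $ p $ (v, l) else 0)"
  by (simp add: fibre_copy_def matrix_matrix_mult_def sum_pair_UNIV
        if_distrib[of "\<lambda>x. _ * x"] cong: if_cong)
     (simp add: sum.swap[of _ UNIV UNIV] cong: if_cong)

lemma matrix_diff_ldistrib: "(A :: 'a::ring_1^'n^'m) ** (B - C) = A ** B - A ** C"
  by (simp add: vec_eq_iff matrix_matrix_mult_def right_diff_distrib sum_subtractf)

lemma matrix_diff_rdistrib: "(A - B) ** (C :: 'a::ring_1^'n^'m) = A ** C - B ** C"
  by (simp add: vec_eq_iff matrix_matrix_mult_def left_diff_distrib sum_subtractf)

lemma matrix_mult_add_rdistrib: "(A + B) ** (C :: 'a::semiring_1^'n^'m) = A ** C + B ** C"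
  by (simp add: vec_eq_iff matrix_matrix_mult_def distrib_right sum.distrib)

lemma fibre_copy_idem: "fibre_copy i0 ** fibre_copy i0 = fibre_copy i0"
  by (simp add: vec_eq_iff fibre_copy_mult) (simp add: fibre_copy_def)

text \<open>Hypothesis \<open>B\<close> says that the fibres form an equitable partition for
  \<open>D\<close> with quotient matrix \<open>B\<close>.\<close>

lemma mult_fibre_copy_quotient:
  fixes D :: "'a::comm_ring_1^('v::finite \<times> 'r::finite)^('v \<times> 'r)" and B :: "'a^'v^'v"
  assumes B: "\<And>u j w. (\<Sum>l\<in>UNIV. D $ (u, j) $ (w, l)) = B $ u $ w"
  shows "(D ** fibre_copy i0) $ (u, j) $ (v, i) = (if i = i0 then B $ u $ v else 0)"
  by (simp add: mult_fibre_copy B)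

text \<open>The image of \<open>P\<close>, the vectors constant on fibres, is preserved by
  \<open>D\<close>.\<close>

lemma fibre_copy_absorb:
  fixes D :: "'a::comm_ring_1^('v::finite \<times> 'r::finite)^('v \<times> 'r)" and B :: "'a^'v^'v"
  assumes B: "\<And>u j w. (\<Sum>l\<in>UNIV. D $ (u, j) $ (w, l)) = B $ u $ w"
  shows "fibre_copy i0 ** (D ** fibre_copy i0) = D ** fibre_copy i0"
  by (simp add: vec_eq_iff fibre_copy_mult mult_fibre_copy_quotient[OF B] split_paired_all)

text \<open>With \<open>Q = mat 1 - P\<close> one has \<open>D = (P + D Q) (D P + Q)\<close>,
  because \<open>P Q = 0\<close> and \<open>Q D P = 0\<close>. The second factor has identity
  columns outside the layer \<open>i0\<close> and the block \<open>B\<close> on that layer.\<close>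

lemma det_fibre_factor:
  fixes D :: "'a::comm_ring_1^('v::finite \<times> 'r::finite)^('v \<times> 'r)" and B :: "'a^'v^'v"
  assumes B: "\<And>u j w. (\<Sum>l\<in>UNIV. D $ (u, j) $ (w, l)) = B $ u $ w"
  shows "det D = det (fibre_copy i0 + D ** (mat 1 - fibre_copy i0)) * det B"
proof -
  let ?P = "fibre_copy i0 :: 'a^('v \<times> 'r)^('v \<times> 'r)"
  let ?K = "D ** ?P + (mat 1 - ?P)"
  note DP = mult_fibre_copy_quotient[OF B] and PP = fibre_copy_idem and PDP = fibre_copy_absorb[OF B]
  have "(?P + D ** (mat 1 - ?P)) ** ?K = D"
  proof -
    have "(mat 1 - ?P) ** (D ** ?P) = 0"
      using PDP by (simp add: matrix_diff_rdistrib)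
    moreover have "(mat 1 - ?P) ** (mat 1 - ?P) = mat 1 - ?P"
      by (simp add: matrix_diff_rdistrib matrix_diff_ldistrib PP)
    moreover have "?P ** (mat 1 - ?P) = 0"
      by (simp add: matrix_diff_ldistrib PP)
    ultimately have "(?P + D ** (mat 1 - ?P)) ** ?K = D ** ?P + D ** (mat 1 - ?P)"
      by (simp add: matrix_mult_add_rdistrib matrix_add_ldistrib PDP matrix_mul_assoc[symmetric])
    then show ?thesis by (simp add: matrix_diff_ldistrib)
  qed
  then have "det D = det (?P + D ** (mat 1 - ?P)) * det ?K"
    by (metis det_mul)
  moreover have "det ?K = det B"
  proof (rule det_block_identity_columns[where h = "\<lambda>v. (v, i0)"])
    show "inj (\<lambda>v. (v, i0))" by (auto simp: inj_on_def)
    show "?K $ (u, i0) $ (v, i0) = B $ u $ v" for u v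
      by (simp add: DP) (auto simp: fibre_copy_nth mat_def)
    show "?K $ p $ q = (if p = q then 1 else 0)" if "q \<notin> range (\<lambda>v. (v, i0))" for p q
      using that by (cases p; cases q) (auto simp: DP fibre_copy_nth mat_def)
  qed
  ultimately show ?thesis by simp
qed

lemma poly_det: "poly (det M) x = det (\<chi> i j. poly (M $ i $ j) x)"
  by (simp add: det_def poly_sum poly_prod)

text \<open>The cofactor \<open>q\<close> is the determinant of the first factor above for
  \<open>D = x I - A\<close>. It stands for the characteristic polynomial of \<open>A\<close> on the
  vectors with zero fibre sums: each eigenvalue occurring there is a root of
  \<open>q\<close>.\<close>

lemma charpoly_cover_factor:
  fixes A :: "complex^('v::finite \<times> 'r::finite)^('v \<times> 'r)" and B :: "complex^'v^'v"
  assumes B: "\<And>u j w. (\<Sum>l\<in>UNIV. A $ (u, j) $ (w, l)) = B $ u $ w"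
  obtains q where "charpoly A = q * charpoly B"
    and "\<And>\<nu> x. A *v x = \<nu> *s x \<Longrightarrow> x \<noteq> 0 \<Longrightarrow> (\<And>u. (\<Sum>i\<in>UNIV. x $ (u, i)) = 0) \<Longrightarrow> poly q \<nu> = 0"
proof -
  fix i0 :: 'r
  define D where "D = (\<chi> i j. (if i = j then [:0, 1:] else 0) - [:A $ i $ j:])"
  define DB where "DB = (\<chi> i j. (if i = j then [:0, 1:] else 0) - [:B $ i $ j:])"
  define q where "q = det (fibre_copy i0 + D ** (mat 1 - fibre_copy i0))"
  have "(\<Sum>l\<in>UNIV. D $ (u, j) $ (w, l)) = DB $ u $ w" for u j w
    by (simp add: D_def DB_def sum_subtractf sum_to_poly B cong: if_cong)
  from det_fibre_factor[OF this]
  have "charpoly A = q * charpoly B"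
    by (simp add: q_def charpoly_def D_def DB_def)
  moreover have "poly q \<nu> = 0"
    if eig: "A *v x = \<nu> *s x" and nz: "x \<noteq> 0" and W: "\<And>u. (\<Sum>i\<in>UNIV. x $ (u, i)) = 0" for \<nu> x
  proof -
    let ?P = "fibre_copy i0 :: complex^('v \<times> 'r)^('v \<times> 'r)"
    define N where "N = (\<chi> i j. (if i = j then \<nu> else 0) - A $ i $ j)"
    define K where "K = ?P + N ** (mat 1 - ?P)"
    have fib: "(\<Sum>l\<in>UNIV. N $ (u, j) $ (w, l)) = (\<chi> u w. (if u = w then \<nu> else 0) - B $ u $ w) $ u $ w" for u j w
      by (simp add: N_def sum_subtractf B cong: if_cong)
    have "(\<chi> i j. poly ((fibre_copy i0 + D ** (mat 1 - fibre_copy i0)) $ i $ j) \<nu>) = K"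
      by (simp add: vec_eq_iff K_def matrix_matrix_mult_def poly_sum D_def N_def fibre_copy_def mat_def
          if_distrib[of "\<lambda>p. poly p \<nu>"] cong: if_cong)
    then have qK: "poly q \<nu> = det K" by (simp add: q_def poly_det)
    have Nx: "N *v x = 0"
      using eig by (simp add: vec_eq_iff N_def matrix_vector_mult_def left_diff_distrib sum_subtractf
          if_distrib[of "\<lambda>a. a * _"] cong: if_cong)
    define z where "z = N *v (?P *v x)"
    have Pz: "?P *v z = z"
      unfolding z_def using fibre_copy_absorb[OF fib, of i0] by (simp add: matrix_vector_mul_assoc)
    have PPx: "?P *v (?P *v x) = ?P *v x"
      by (simp add: matrix_vector_mul_assoc fibre_copy_idem)
    \<comment> \<open>A kernel vector of \<open>K\<close>: \<open>P y = z = N P x\<close>, while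
      \<open>N (y - P y) = N x - N P x = - z\<close> because \<open>N x = 0\<close>.\<close>
    define y where "y = x - ?P *v x + z"
    have Qy: "y - ?P *v y = x - ?P *v x"
      by (simp add: y_def matrix_vector_right_distrib matrix_vector_mult_diff_distrib PPx Pz)
    have "K *v y = ?P *v y + N *v (y - ?P *v y)"
      by (simp add: K_def matrix_vector_mult_add_rdistrib matrix_vector_mul_assoc[symmetric]
          matrix_vector_mult_diff_rdistrib)
    also have "\<dots> = 0"
      unfolding Qy by (simp add: y_def matrix_vector_right_distrib matrix_vector_mult_diff_distrib PPx Pz Nx)
        (simp add: z_def)
    finally have Ky: "K *v y = 0" .
    \<comment> \<open>If \<open>y = 0\<close>, then \<open>x\<close> is constant on fibres, and zero
      fibre sums force \<open>x = 0\<close>.\<close>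
    have "y \<noteq> 0"
    proof
      assume "y = 0"
      then have "x = ?P *v x" using Qy by simp
      then have copy: "x $ p = x $ (fst p, i0)" for p by (metis fibre_copy_vec)
      have "x $ (u, i0) = 0" for u
      proof -
        have "(\<Sum>i\<in>(UNIV :: 'r set). x $ (u, i)) = (\<Sum>i\<in>(UNIV :: 'r set). x $ (u, i0))"
          by (intro sum.cong refl) (subst copy, simp)
        then show ?thesis using W[of u] by simp
      qed
      then have "x = 0" using copy by (metis vec_eq_iff zero_index)
      with nz show False by simp
    qed
    then have "\<not> invertible K"
      using Ky by (metis invertible_def matrix_left_invertible_ker)
    then show ?thesis using qK invertible_det_nz by metis
  qed
  ultimately show ?thesis using that by blast
qed

section \<open>Real symmetric matrices with two eigenvalues on an invariant subspace\<close>

text \<open>The vector \<open>p(A) x\<close>. For fixed \<open>x\<close> these vectors form the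
  Krylov space of \<open>x\<close>, which lies in every invariant subspace containing
  \<open>x\<close>.\<close>

definition poly_apply :: "complex^'n^'n \<Rightarrow> complex poly \<Rightarrow> complex^'n \<Rightarrow> complex^'n" where
  "poly_apply A p x = (\<Sum>i\<le>degree p. coeff p i *s (((*v) A ^^ i) x))"

lemma poly_apply_upto:
  "degree p \<le> n \<Longrightarrow> poly_apply A p x = (\<Sum>i\<le>n. coeff p i *s (((*v) A ^^ i) x))"
  unfolding poly_apply_def by (rule sum.mono_neutral_left) (auto simp: coeff_eq_0)

lemma poly_apply_0 [simp]: "poly_apply A 0 x = 0"
  by (simp add: poly_apply_def)

lemma matrix_vector_mult_sum: "(A :: complex^'n^'m) *v (\<Sum>i\<in>S. g i) = (\<Sum>i\<in>S. A *v g i)"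
  by (induction S rule: infinite_finite_induct) (simp_all add: matrix_vector_right_distrib)

lemma poly_apply_pCons [simp]:
  "poly_apply A (pCons a p) x = a *s x + A *v poly_apply A p x"
proof -
  have "poly_apply A (pCons a p) x =
      (\<Sum>i\<le>Suc (degree p). coeff (pCons a p) i *s (((*v) A ^^ i) x))"
    by (rule poly_apply_upto) (rule degree_pCons_le)
  also have "\<dots> = a *s x + (\<Sum>i\<le>degree p. coeff p i *s (A *v (((*v) A ^^ i) x)))"
    by (subst sum.atMost_Suc_shift) simp
  also have "(\<Sum>i\<le>degree p. coeff p i *s (A *v (((*v) A ^^ i) x))) = A *v poly_apply A p x"
    by (simp add: poly_apply_def matrix_vector_mult_sum vector_scalar_commute)
  finally show ?thesis .
qed

lemma poly_apply_add: "poly_apply A (p + q) x = poly_apply A p x + poly_apply A q x"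
proof -
  let ?n = "max (degree p) (degree q)"
  have "degree (p + q) \<le> ?n" by (rule degree_add_le_max)
  then show ?thesis
    by (simp add: poly_apply_upto[of _ ?n] sum.distrib vec.scale_left_distrib)
qed

lemma poly_apply_smult: "poly_apply A (smult a p) x = a *s poly_apply A p x"
  by (cases "a = 0") (simp_all add: poly_apply_def vec.scale_sum_right vector_smult_assoc)

lemma poly_apply_linear_factor:
  "poly_apply A ([:- \<nu>, 1:] * p) x = A *v poly_apply A p x - \<nu> *s poly_apply A p x"
proof -
  have "[:- \<nu>, 1:] * p = smult (- \<nu>) p + pCons 0 p" by simp
  then show ?thesis
    unfolding \<open>[:- \<nu>, 1:] * p = _\<close> poly_apply_add poly_apply_smult poly_apply_pCons by simp
qed

lemma poly_apply_shift_commute: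
  "poly_apply A p (A *v x - \<nu> *s x) = A *v poly_apply A p x - \<nu> *s poly_apply A p x"
proof (induction p)
  case (pCons a p)
  then show ?case
    by (simp add: matrix_vector_right_distrib matrix_vector_mult_diff_distrib vector_scalar_commute
        vec.scale_right_distrib vec.scale_right_diff_distrib mult.commute)
qed simp

lemma poly_apply_in_subspace:
  assumes "vec.subspace W" "\<And>w. w \<in> W \<Longrightarrow> A *v w \<in> W" "x \<in> W"
  shows "poly_apply A p x \<in> W"
proof (induction p)
  case 0
  show ?case using assms(1) by (simp add: vec.subspace_0)
next
  case (pCons a p)
  then show ?case using assms by (simp add: vec.subspace_add vec.subspace_scale)
qed

text \<open>In dimension \<open>CARD('n)\<close>, the \<open>CARD('n) + 1\<close> iterates of
  \<open>x\<close> under \<open>A\<close> are linearly dependent.\<close>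

lemma annihilating_poly_exists:
  fixes A :: "complex^'n^'n"
  shows "\<exists>p. p \<noteq> 0 \<and> poly_apply A p x = 0"
proof -
  let ?v = "\<lambda>i. ((*v) A ^^ i) x"
  let ?n = "CARD('n)"
  have "\<exists>c. (\<exists>i\<le>?n. c i \<noteq> 0) \<and> (\<Sum>i\<le>?n. c i *s ?v i) = 0"
  proof (cases "inj_on ?v {..?n}")
    case True
    have "vec.dependent (?v ` {..?n})"
    proof (rule ccontr)
      assume "\<not> vec.dependent (?v ` {..?n})"
      from vec.independent_card_le_dim[OF subset_UNIV this] have "card (?v ` {..?n}) \<le> ?n"
        unfolding vec_dim_card .
      then show False using card_image[OF True] by simp
    qed
    then obtain u v where "v \<in> ?v ` {..?n}" "u v \<noteq> 0" "(\<Sum>v\<in>?v ` {..?n}. u v *s v) = 0"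
      using vec.dependent_finite[of "?v ` {..?n}"] by auto
    then show ?thesis
      by (intro exI[of _ "\<lambda>i. u (?v i)"]) (auto simp: sum.reindex[OF True])
  next
    \<comment> \<open>Dependence of a set ignores repetitions, so a coincidence of two iterates is
      treated separately; the relation is their difference.\<close>
    case False
    then obtain i j where ij: "i \<le> ?n" "j \<le> ?n" "i \<noteq> j" "?v i = ?v j"
      by (auto simp: inj_on_def)
    have "(\<Sum>l\<le>?n. (if l = i then 1 else if l = j then -1 else 0) *s ?v l) =
        (\<Sum>l\<le>?n. (if l = i then ?v i else 0) - (if l = j then ?v i else 0))"
      using ij by (intro sum.cong) auto
    also have "\<dots> = 0" using ij by (simp add: sum_subtractf)
    finally show ?thesis
      using ij by (intro exI[of _ "\<lambda>l. if l = i then 1 else if l = j then -1 else 0"]) auto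
  qed
  then obtain c i where c: "i \<le> ?n" "c i \<noteq> 0" "(\<Sum>i\<le>?n. c i *s ?v i) = 0" by blast
  define p where "p = (\<Sum>i\<le>?n. monom (c i) i)"
  have coeff: "coeff p i = (if i \<le> ?n then c i else 0)" for i
    by (simp add: p_def coeff_sum)
  then have "degree p \<le> ?n" by (intro degree_le) simp
  then have "poly_apply A p x = (\<Sum>i\<le>?n. c i *s ?v i)"
    by (simp add: poly_apply_upto[of p ?n] coeff)
  moreover have "p \<noteq> 0" using coeff[of i] c by auto
  ultimately show ?thesis using c by auto
qed

text \<open>Split a root \<open>\<nu>\<close> off an annihilating polynomial of least degree: the
  cofactor does not annihilate \<open>x\<close>, and \<open>A - \<nu>\<close> kills the resulting
  vector. The form \<open>p(A) x\<close> keeps the eigenvector inside invariant subspaces.\<close>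

lemma krylov_eigenvector:
  fixes A :: "complex^'n^'n"
  assumes "x \<noteq> 0"
  obtains p \<nu> where "poly_apply A p x \<noteq> 0" "A *v poly_apply A p x = \<nu> *s poly_apply A p x"
proof -
  obtain p where p: "p \<noteq> 0" "poly_apply A p x = 0"
    and least: "\<And>q. q \<noteq> 0 \<Longrightarrow> poly_apply A q x = 0 \<Longrightarrow> degree p \<le> degree q"
    using ex_has_least_nat[of "\<lambda>p. p \<noteq> 0 \<and> poly_apply A p x = 0" _ degree] annihilating_poly_exists[of A x]
    by blast
  have "\<not> constant (poly p)"
  proof
    assume "constant (poly p)"
    then have "degree p = 0" by (simp add: constant_degree)
    then obtain a where "p = [:a:]" by (metis degree_eq_zeroE)
    then show False using p assms by simp
  qed
  then obtain \<nu> where "poly p \<nu> = 0" using fundamental_theorem_of_algebra by blast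
  then obtain q where q: "p = [:- \<nu>, 1:] * q" by (auto simp: poly_eq_0_iff_dvd)
  then have "q \<noteq> 0" using p by auto
  then have "degree p = Suc (degree q)" unfolding q by (subst degree_mult_eq) auto
  then have "poly_apply A q x \<noteq> 0" using least[of q] \<open>q \<noteq> 0\<close> by auto
  moreover have "A *v poly_apply A q x = \<nu> *s poly_apply A q x"
    using p(2) unfolding q poly_apply_linear_factor by simp
  ultimately show ?thesis using that by blast
qed

section \<open>Eigenvalues of real symmetric matrices acting on complex vectors\<close>

text \<open>On complex vectors \<open>inner\<close> is the real part of the hermitian form.
  Multiplication by a real entry is self-adjoint for it, and symmetry of \<open>A\<close> exchanges
  the two indices.\<close>

lemma real_symmetric_self_adjoint:
  fixes A :: "complex^'n^'n"
  assumes "\<And>i j. A $ i $ j = A $ j $ i" "\<And>i j. A $ i $ j \<in> \<real>"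
  shows "inner (A *v x) y = inner x (A *v y)"
proof -
  have *: "inner (A $ i $ j * b) c = inner b (A $ j $ i * c)" for i j b c
  proof -
    obtain t where "A $ j $ i = of_real t" using assms(2) by (meson Reals_cases)
    then show ?thesis by (simp add: assms(1)[of i j] inner_complex_def algebra_simps)
  qed
  have "inner (A *v x) y = (\<Sum>i\<in>UNIV. \<Sum>j\<in>UNIV. inner (A $ i $ j * x $ j) (y $ i))"
    by (simp add: inner_vec_def matrix_vector_mult_def inner_sum_left)
  also have "\<dots> = (\<Sum>j\<in>UNIV. \<Sum>i\<in>UNIV. inner (A $ i $ j * x $ j) (y $ i))"
    by (rule sum.swap)
  also have "\<dots> = inner x (A *v y)"
    by (simp add: inner_vec_def matrix_vector_mult_def inner_sum_right *)
  finally show ?thesis .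
qed

lemma inner_ii_vec: "inner (x :: complex^'n) (\<i> *s x) = 0" "inner (\<i> *s x) x = 0"
  by (simp_all add: inner_vec_def inner_complex_def)

text \<open>Since \<open>inner\<close> is only real bilinear, \<open>x\<close> is paired with
  \<open>\<i> *s x\<close>, to which it is orthogonal. Moving \<open>A\<close> across the pairing
  gives \<open>Im \<nu>\<close> and \<open>- Im \<nu>\<close> times the squared norm of
  \<open>x\<close>.\<close>

lemma real_symmetric_eigenvalue_real:
  fixes A :: "complex^'n^'n"
  assumes A: "\<And>i j. A $ i $ j = A $ j $ i" "\<And>i j. A $ i $ j \<in> \<real>"
    and eig: "A *v x = \<nu> *s x" and "x \<noteq> 0"
  shows "\<nu> \<in> \<real>"
proof -
  have split: "\<nu> *s y = Re \<nu> *\<^sub>R y + Im \<nu> *\<^sub>R (\<i> *s y)" for y :: "complex^'n"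
    by (simp add: vec_eq_iff complex_eq_iff)
  have "inner (A *v x) (\<i> *s x) = inner x (A *v (\<i> *s x))"
    by (rule real_symmetric_self_adjoint[OF A])
  also have "A *v (\<i> *s x) = \<i> *s (\<nu> *s x)"
    by (simp add: vector_scalar_commute eig)
  also have "\<dots> = \<nu> *s (\<i> *s x)" by (simp add: vector_smult_assoc mult.commute)
  finally have "Im \<nu> * inner (\<i> *s x) (\<i> *s x) = - Im \<nu> * inner x x"
    unfolding eig split by (simp add: inner_ii_vec inner_add_left inner_add_right inner_diff_right vector_smult_assoc)
  moreover have "inner (\<i> *s x) (\<i> *s x) = inner x x"
    by (simp add: inner_vec_def inner_complex_def add.commute)
  ultimately have "Im \<nu> * inner x x = 0" by simp
  then have "Im \<nu> = 0" using \<open>x \<noteq> 0\<close> by simp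
  then show ?thesis by (simp add: complex_is_Real_iff)
qed

text \<open>There are no Jordan chains of length two: as \<open>\<nu>\<close> is real,
  \<open>A - \<nu>\<close> is self-adjoint, so
  \<open>inner z z = inner ((A - \<nu>) z) y = 0\<close>.\<close>

lemma real_symmetric_no_generalized_eigenvector:
  fixes A :: "complex^'n^'n"
  assumes A: "\<And>i j. A $ i $ j = A $ j $ i" "\<And>i j. A $ i $ j \<in> \<real>"
    and z: "z = A *v y - \<nu> *s y" and eig: "A *v z = \<nu> *s z"
  shows "z = 0"
proof (rule ccontr)
  assume "z \<noteq> 0"
  then obtain t where t: "\<nu> = of_real t"
    using real_symmetric_eigenvalue_real[OF A eig] by (meson Reals_cases)
  have scale: "\<nu> *s w = t *\<^sub>R w" for w :: "complex^'n"
    by (simp add: t vec_eq_iff complex_eq_iff)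
  have "inner z z = inner z (A *v y) - t * inner z y"
    by (subst (2) z) (simp add: scale inner_diff_right)
  also have "inner z (A *v y) = inner (A *v z) y"
    by (rule real_symmetric_self_adjoint[OF A, symmetric])
  finally have "inner z z = 0" by (simp add: eig scale)
  with \<open>z \<noteq> 0\<close> show False by simp
qed

text \<open>Otherwise the Krylov space of the offending vector contains an eigenvector in
  \<open>W\<close>, with eigenvalue \<open>\<theta>\<close> or \<open>\<tau>\<close>. Being also in
  the image of \<open>A\<close> minus that eigenvalue, it ends a Jordan chain, which is
  impossible.\<close>

lemma two_eigenvalues_annihilate:
  fixes A :: "complex^'n^'n"
  assumes A: "\<And>i j. A $ i $ j = A $ j $ i" "\<And>i j. A $ i $ j \<in> \<real>"
    and W: "vec.subspace W" "\<And>w. w \<in> W \<Longrightarrow> A *v w \<in> W" "x \<in> W"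
    and eig: "\<And>w \<nu>. w \<in> W \<Longrightarrow> w \<noteq> 0 \<Longrightarrow> A *v w = \<nu> *s w \<Longrightarrow> \<nu> = \<theta> \<or> \<nu> = \<tau>"
  shows "A *v (A *v x) - (\<theta> + \<tau>) *s (A *v x) + (\<theta> * \<tau>) *s x = 0"
proof (rule ccontr)
  let ?y = "A *v (A *v x) - (\<theta> + \<tau>) *s (A *v x) + (\<theta> * \<tau>) *s x"
  \<comment> \<open>Both orders of the two factors, so that the factor of the eigenvalue found can
    be put outermost.\<close>
  have y: "?y = A *v (A *v x - \<theta> *s x) - \<tau> *s (A *v x - \<theta> *s x)"
      "?y = A *v (A *v x - \<tau> *s x) - \<theta> *s (A *v x - \<tau> *s x)"
    by (simp_all add: matrix_vector_mult_diff_distrib vector_scalar_commute vec_eq_iff algebra_simps)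
  assume "?y \<noteq> 0"
  then obtain p \<nu> where p: "poly_apply A p ?y \<noteq> 0"
      "A *v poly_apply A p ?y = \<nu> *s poly_apply A p ?y"
    by (rule krylov_eigenvector)
  have "?y \<in> W"
    using W by (simp add: vec.subspace_add vec.subspace_diff vec.subspace_scale)
  then have "poly_apply A p ?y \<in> W" by (intro poly_apply_in_subspace W)
  then consider "\<nu> = \<theta>" | "\<nu> = \<tau>" using eig p by blast
  then show False
  proof cases
    case 1
    have "poly_apply A p ?y = A *v poly_apply A p (A *v x - \<tau> *s x) - \<theta> *s poly_apply A p (A *v x - \<tau> *s x)"
      unfolding y(2) by (rule poly_apply_shift_commute)
    from real_symmetric_no_generalized_eigenvector[OF A this] have "poly_apply A p ?y = 0"
      using p(2) 1 by simp
    with p show False by simp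
  next
    case 2
    have "poly_apply A p ?y = A *v poly_apply A p (A *v x - \<theta> *s x) - \<tau> *s poly_apply A p (A *v x - \<theta> *s x)"
      unfolding y(1) by (rule poly_apply_shift_commute)
    from real_symmetric_no_generalized_eigenvector[OF A this] have "poly_apply A p ?y = 0"
      using p(2) 2 by simp
    with p show False by simp
  qed
qed

section \<open>Common neighbours in a covering graph\<close>

text \<open>By \<open>step\<close>, \<open>D\<close> grows by at most one along each edge of a walk
  from \<open>x\<close>, so it is a lower bound. By \<open>pred\<close>, a walk of length
  \<open>D y\<close> can be traced back from \<open>y\<close> to \<open>x\<close>.\<close>

lemma gdist_eqI:
  fixes D :: "'a \<Rightarrow> nat"
  assumes zero: "\<And>y. D y = 0 \<longleftrightarrow> y = x"
    and step: "\<And>y z. C y z \<Longrightarrow> D z \<le> Suc (D y)"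
    and pred: "\<And>y m. D y = Suc m \<Longrightarrow> \<exists>z. C z y \<and> D z = m"
  shows "gdist C x y = D y" and "C\<^sup>*\<^sup>* x y"
proof -
  have le: "(C ^^ m) x y \<Longrightarrow> D y \<le> m" for m y
  proof (induction m arbitrary: y)
    case 0
    then show ?case using zero[of x] by simp
  next
    case (Suc m)
    then obtain z where "(C ^^ m) x z" "C z y" by auto
    then show ?case using Suc.IH[of z] step[of z y] by linarith
  qed
  have walk: "D y = m \<Longrightarrow> (C ^^ m) x y" for m y
  proof (induction m arbitrary: y)
    case 0
    then show ?case using zero by simp
  next
    case (Suc m)
    then obtain z where "C z y" "D z = m" using pred by blast
    then show ?case using Suc.IH relpowp_Suc_I by metis
  qed
  show "gdist C x y = D y"
    unfolding gdist_def by (rule Least_equality) (use walk le in auto)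
  show "C\<^sup>*\<^sup>* x y"
    using walk[OF refl] relpowp_imp_rtranclp by fastforce
qed

lemma gdist_eq_2:
  assumes "x \<noteq> y" "\<not> C x y" "C x z" "C z y"
  shows "gdist C x y = 2"
  unfolding gdist_def
proof (rule Least_equality)
  show "(C ^^ 2) x y" using assms by (auto simp: numeral_2_eq_2)
  fix m assume m: "(C ^^ m) x y"
  have "m \<noteq> 0" using m assms by (metis relpowp_0_E)
  moreover have "m \<noteq> 1" using m assms by (metis relpowp_1)
  ultimately show "2 \<le> m" by linarith
qed

lemma gdist_eq_3:
  assumes "x \<noteq> y" "\<not> C x y" "\<And>z. C x z \<Longrightarrow> \<not> C z y" "C x z" "C z w" "C w y"
  shows "gdist C x y = 3"
  unfolding gdist_def
proof (rule Least_equality)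
  show "(C ^^ 3) x y" using assms by (auto simp: numeral_3_eq_3)
  fix m assume m: "(C ^^ m) x y"
  have "m \<noteq> 0" using m assms by (metis relpowp_0_E)
  moreover have "m \<noteq> 1" using m assms by (metis relpowp_1)
  moreover have "m \<noteq> 2" using m assms by (auto simp: numeral_2_eq_2)
  ultimately show "3 \<le> m" by linarith
qed

lemma axis_nth_if: "axis q a $ x = (if x = q then a else 0)"
  by (simp add: axis_def)

lemma matrix_vector_mult_axis_nth: "((A :: 'a::semiring_1^'n^'m) *v axis q 1) $ x = A $ x $ q"
  by (simp add: matrix_vector_mult_def axis_nth_if if_distrib[of "\<lambda>x. _ * x"] cong: if_cong)

lemma adj_matrix_nth: "adj_matrix E $ u $ v = (if E u v then 1 else 0)"
  by (simp add: adj_matrix_def)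

section \<open>Spectrum and counts for a locally bijective projection\<close>

text \<open>The arc function is replaced by the combinatorial property that \<open>fst\<close> maps
  the neighbours of each vertex bijectively to those of its image.\<close>

locale covering =
  fixes E :: "'v::finite \<Rightarrow> 'v \<Rightarrow> bool" and C :: "'v \<times> 'r::finite \<Rightarrow> 'v \<times> 'r \<Rightarrow> bool"
  assumes E_sym: "E u v \<Longrightarrow> E v u" and E_irrefl: "\<not> E u u"
    and C_sym: "C x y \<Longrightarrow> C y x"
    and C_proj: "C x y \<Longrightarrow> E (fst x) (fst y)"
    and C_lift: "E (fst x) v \<Longrightarrow> \<exists>!j. C x (v, j)"
begin

definition common :: "'v \<times> 'r \<Rightarrow> 'v \<times> 'r \<Rightarrow> nat" where
  "common x y = card {z. C x z \<and> C z y}"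

lemma lift_unique: "C x y \<Longrightarrow> C x z \<Longrightarrow> fst y = fst z \<Longrightarrow> y = z"
  using C_lift[of x "fst y"] C_proj[of x y] by (metis prod.collapse)

lemma card_lift: "card {z. C y z \<and> P (fst z)} = card {v. E (fst y) v \<and> P v}"
proof -
  have "inj_on fst {z. C y z \<and> P (fst z)}"
    by (rule inj_onI) (use lift_unique in blast)
  moreover have "fst ` {z. C y z \<and> P (fst z)} = {v. E (fst y) v \<and> P v}"
  proof (intro equalityI subsetI)
    fix v assume v: "v \<in> {v. E (fst y) v \<and> P v}"
    then obtain j where "C y (v, j)" using C_lift by blast
    with v show "v \<in> fst ` {z. C y z \<and> P (fst z)}" by force
  next
    fix v assume "v \<in> fst ` {z. C y z \<and> P (fst z)}"
    then show "v \<in> {v. E (fst y) v \<and> P v}" using C_proj by blast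
  qed
  ultimately show ?thesis by (metis card_image)
qed

text \<open>A common neighbour would have two neighbours in one fibre.\<close>

lemma common_same_fibre:
  assumes "fst x = fst y" "x \<noteq> y"
  shows "common x y = 0"
proof -
  have "\<not> (C x z \<and> C z y)" for z
    using lift_unique[of z x y] C_sym assms by blast
  then show ?thesis by (simp add: common_def)
qed

lemma adj_fibre_sum:
  "(\<Sum>l\<in>UNIV. adj_matrix C $ (u, j) $ (w, l)) = adj_matrix E $ u $ w"
proof (cases "E u w")
  case True
  then obtain i where "C (u, j) (w, i)" "\<And>l. C (u, j) (w, l) \<Longrightarrow> l = i"
    using C_lift[of "(u, j)" w] by auto
  then have "C (u, j) (w, l) \<longleftrightarrow> l = i" for l by blast
  with True show ?thesis by (simp add: adj_matrix_def)
next
  case False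
  then have "\<not> C (u, j) (w, l)" for l using C_proj by fastforce
  with False show ?thesis by (simp add: adj_matrix_def)
qed

lemma adj_square: "(adj_matrix C ** adj_matrix C) $ x $ y = of_nat (common x y)"
  by (simp add: adj_matrix_def matrix_matrix_mult_def common_def if_distrib[of "\<lambda>x. x * _"] cong: if_cong)
    (simp add: sum.If_cases Collect_conj_eq)

lemma adj_base_square:
  "(adj_matrix E ** adj_matrix E) $ u $ w = of_nat (card {v. E u v \<and> E v w})"
  by (simp add: adj_matrix_def matrix_matrix_mult_def if_distrib[of "\<lambda>x. x * _"] cong: if_cong)
    (simp add: sum.If_cases Collect_conj_eq)

text \<open>Equitability passes to products: the quotient of the square is the square of the
  quotient.\<close>

lemma common_fibre_sum:
  "(\<Sum>l\<in>UNIV. (adj_matrix C ** adj_matrix C) $ (u, j) $ (w, l)) = (adj_matrix E ** adj_matrix E) $ u $ w"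
proof -
  let ?A = "adj_matrix C" and ?B = "adj_matrix E"
  have "(\<Sum>l\<in>UNIV. (?A ** ?A) $ (u, j) $ (w, l)) = (\<Sum>l\<in>UNIV. \<Sum>z\<in>UNIV. ?A $ (u, j) $ z * ?A $ z $ (w, l))"
    by (simp add: matrix_matrix_mult_def)
  also have "\<dots> = (\<Sum>z\<in>UNIV. ?A $ (u, j) $ z * (\<Sum>l\<in>UNIV. ?A $ z $ (w, l)))"
    by (subst sum.swap) (simp add: sum_distrib_left)
  also have "\<dots> = (\<Sum>v\<in>UNIV. \<Sum>i\<in>UNIV. ?A $ (u, j) $ (v, i) * ?B $ v $ w)"
    by (simp add: sum_pair_UNIV adj_fibre_sum)
  also have "\<dots> = (?B ** ?B) $ u $ w"
    by (simp add: sum_distrib_right[symmetric] adj_fibre_sum) (simp add: matrix_matrix_mult_def)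
  finally show ?thesis .
qed

text \<open>Here \<open>s\<close> and \<open>p\<close> are the sum and product of the two extra
  eigenvalues. The matrix \<open>A A - s A + p\<close> annihilates all vectors with zero fibre
  sums.\<close>

lemma fibre_constant:
  assumes two_ev: "card (set_mset (Spec (adj_matrix C) - Spec (adj_matrix E))) = 2"
  obtains s p :: complex where "\<And>x w i j.
      of_nat (common x (w, i)) - s * (if C x (w, i) then 1 else 0) + p * (if x = (w, i) then 1 else 0) =
      of_nat (common x (w, j)) - s * (if C x (w, j) then 1 else 0) + p * (if x = (w, j) then 1 else 0)"
proof -
  let ?A = "adj_matrix C"
  obtain q where q: "charpoly ?A = q * charpoly (adj_matrix E)"
    and root: "\<And>\<nu> x. ?A *v x = \<nu> *s x \<Longrightarrow> x \<noteq> 0 \<Longrightarrow> (\<And>u. (\<Sum>i\<in>UNIV. x $ (u, i)) = 0) \<Longrightarrow> poly q \<nu> = 0"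
    using charpoly_cover_factor[OF adj_fibre_sum] by blast
  \<comment> \<open>The zero polynomial has the empty multiset as \<open>proots\<close>, which would
    leave no extra eigenvalue.\<close>
  have nz: "charpoly ?A \<noteq> 0"
    using two_ev by (auto simp: Spec_def)
  then have "Spec ?A - Spec (adj_matrix E) = proots q"
    unfolding Spec_def q by (subst proots_mult) auto
  moreover have "q \<noteq> 0" using nz q by auto
  ultimately have "card {x. poly q x = 0} = 2" using two_ev by simp
  then obtain \<theta> \<tau> where roots: "{x. poly q x = 0} = {\<theta>, \<tau>}" by (metis card_2_iff)
  define W :: "(complex^('v \<times> 'r)) set" where "W = {x. \<forall>u. (\<Sum>i\<in>UNIV. x $ (u, i)) = 0}"
  have sub: "vec.subspace W"
    by (simp add: W_def vec.subspace_def sum.distrib sum_distrib_left[symmetric])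
  have A_sym: "?A $ x $ y = ?A $ y $ x" for x y
    using C_sym by (auto simp: adj_matrix_def)
  have A_real: "?A $ x $ y \<in> \<real>" for x y by (simp add: adj_matrix_def)
  \<comment> \<open>By symmetry the column sums of \<open>A\<close> over a fibre are entries of the
    base matrix as well.\<close>
  have inv: "?A *v x \<in> W" if x: "x \<in> W" for x
  proof -
    have "(\<Sum>i\<in>UNIV. (?A *v x) $ (u, i)) = 0" for u
    proof -
      have "(\<Sum>i\<in>UNIV. (?A *v x) $ (u, i)) = (\<Sum>i\<in>UNIV. \<Sum>z\<in>UNIV. ?A $ z $ (u, i) * x $ z)"
        by (simp add: matrix_vector_mult_def A_sym)
      also have "\<dots> = (\<Sum>z\<in>UNIV. (\<Sum>i\<in>UNIV. ?A $ z $ (u, i)) * x $ z)"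
        by (subst sum.swap) (simp add: sum_distrib_right)
      also have "\<dots> = (\<Sum>v\<in>UNIV. adj_matrix E $ v $ u * (\<Sum>j\<in>UNIV. x $ (v, j)))"
        by (simp add: sum_pair_UNIV adj_fibre_sum sum_distrib_left)
      also have "\<dots> = 0" using x by (simp add: W_def)
      finally show ?thesis .
    qed
    then show ?thesis by (simp add: W_def)
  qed
  have eig: "\<nu> = \<theta> \<or> \<nu> = \<tau>" if "x \<in> W" "x \<noteq> 0" "?A *v x = \<nu> *s x" for x \<nu>
    using root[of x \<nu>] that roots unfolding W_def by blast
  define s p where "s = \<theta> + \<tau>" and "p = \<theta> * \<tau>"
  have ann: "?A *v (?A *v x) - s *s (?A *v x) + p *s x = 0" if "x \<in> W" for x
    unfolding s_def p_def by (rule two_eigenvalues_annihilate[OF A_sym A_real sub inv that eig])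
  have "of_nat (common x (w, i)) - s * (if C x (w, i) then 1 else 0) + p * (if x = (w, i) then 1 else 0)
      = of_nat (common x (w, j)) - s * (if C x (w, j) then 1 else 0) + p * (if x = (w, j) then 1 else 0)" for x w i j
  proof -
    \<comment> \<open>Differences of unit vectors of one fibre have zero fibre sums; on them
      annihilation says that two columns agree.\<close>
    let ?e = "axis (w, i) 1 - axis (w, j) (1 :: complex)"
    have "?e \<in> W"
    proof -
      have "(\<Sum>l\<in>UNIV. axis (w, i) (1 :: complex) $ (u, l)) = (if u = w then 1 else 0)" for u and i :: 'r
        by (cases "u = w") (simp_all add: axis_def)
      then show ?thesis by (simp add: W_def sum_subtractf)
    qed
    from arg_cong[OF ann[OF this], of "\<lambda>v. v $ x"]
    have "(of_nat (common x (w, i)) - of_nat (common x (w, j)))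
        - s * ((if C x (w, i) then 1 else 0) - (if C x (w, j) then 1 else 0))
        + p * ((if x = (w, i) then 1 else 0) - (if x = (w, j) then 1 else 0)) = 0"
      by (simp only: matrix_vector_mult_diff_distrib matrix_vector_mul_assoc matrix_vector_mult_axis_nth
          adj_square adj_matrix_nth axis_nth_if vector_minus_component vector_add_component
          vector_smult_component zero_index)
    moreover have "a - s * c + p * e = b - s * d + p * g"
      if "a - b - s * (c - d) + p * (e - g) = 0" for a b c d e g
      using that by (simp add: algebra_simps)
    ultimately show ?thesis by blast
  qed
  then show ?thesis by (rule that)
qed

text \<open>A value constant along a fibre is \<open>1 / r\<close> times its fibre sum, and the
  fibre sum is computed in the base graph.\<close>

lemma common_formula:
  assumes two_ev: "card (set_mset (Spec (adj_matrix C) - Spec (adj_matrix E))) = 2"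
    and r: "CARD('r) \<ge> 2"
    and regular: "\<And>u. card {v. E u v} = k"
  obtains s where "\<And>x y. of_nat CARD('r) * (of_nat (common x y) - s * (if C x y then 1 else 0) - of_nat k * (if x = y then 1 else 0)) =
     of_nat (card {v. E (fst x) v \<and> E v (fst y)}) - s * (if E (fst x) (fst y) then 1 else 0) - (of_nat k * (if fst x = fst y then 1 else 0) :: complex)"
proof -
  obtain s p :: complex where const: "\<And>x w i j.
      of_nat (common x (w, i)) - s * (if C x (w, i) then 1 else 0) + p * (if x = (w, i) then 1 else 0) =
      of_nat (common x (w, j)) - s * (if C x (w, j) then 1 else 0) + p * (if x = (w, j) then 1 else 0)"
    using fibre_constant[OF two_ev] by blast
  define M where "M x y = of_nat (common x y) - s * (if C x y then 1 else 0) + p * (if x = y then 1 else 0)" for x y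
  have M: "M x (w, i) = M x (w, j)" for x w i j
    unfolding M_def by (rule const)
  have sum: "of_nat CARD('r) * M x y = of_nat (card {v. E (fst x) v \<and> E v (fst y)}) - s * (if E (fst x) (fst y) then 1 else 0)
      + p * (if fst x = fst y then 1 else 0)" for x y
  proof -
    obtain u j w i where xy: "x = (u, j)" "y = (w, i)" by (cases x; cases y) auto
    have "of_nat CARD('r) * M x y = (\<Sum>l\<in>(UNIV :: 'r set). M x (w, i))" by (simp add: xy)
    also have "\<dots> = (\<Sum>l\<in>(UNIV :: 'r set). M x (w, l))" by (intro sum.cong refl M)
    also have "\<dots> = (\<Sum>l\<in>UNIV. (adj_matrix C ** adj_matrix C) $ x $ (w, l)) - s * (\<Sum>l\<in>UNIV. adj_matrix C $ x $ (w, l))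
        + p * (\<Sum>l\<in>(UNIV :: 'r set). if x = (w, l) then 1 else 0)"
      unfolding M_def adj_square by (simp add: sum.distrib sum_subtractf sum_distrib_left adj_matrix_def)
    also have "\<dots> = (adj_matrix E ** adj_matrix E) $ u $ w - s * adj_matrix E $ u $ w + p * (if u = w then 1 else 0)"
      unfolding xy common_fibre_sum adj_fibre_sum by simp
    finally show ?thesis unfolding adj_base_square by (simp add: xy adj_matrix_def)
  qed
  obtain i j :: 'r where "i \<noteq> j" using r by (metis One_nat_def card_2_iff' card_le_Suc0_iff_eq finite UNIV_I numeral_2_eq_2 not_less_eq_eq)
  \<comment> \<open>Two distinct vertices of one fibre have entry 0, so the fibre sum
    \<open>k + p\<close> vanishes.\<close>
  have "p = - of_nat k"
  proof -
    fix u
    have "M (u, i) (u, j) = 0"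
      using \<open>i \<noteq> j\<close> common_same_fibre[of "(u, i)" "(u, j)"] C_proj[of "(u, i)" "(u, j)"] E_irrefl
      by (auto simp: M_def)
    moreover have "{v. E u v \<and> E v u} = {v. E u v}" using E_sym by blast
    ultimately show ?thesis using sum[of "(u, i)" "(u, j)"] E_irrefl regular[of u]
      by (simp add: add_eq_0_iff)
  qed
  then show ?thesis using that[of s] sum unfolding M_def by simp
qed

end

section \<open>Distance-regularity of the cover\<close>

text \<open>\<open>even_spread\<close> says that, for two non-adjacent base vertices, their
  \<open>c\<close> common neighbours are shared equally among the lifts. The count over an edge is
  left open; it decides between the two lemmas on \<open>distance_regular\<close>.\<close>

locale srg_covering = covering E C
  for E :: "'v::finite \<Rightarrow> 'v \<Rightarrow> bool" and C :: "'v \<times> 'r::finite \<Rightarrow> 'v \<times> 'r \<Rightarrow> bool" +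
  fixes k a c :: nat
  assumes valency: "card {x. E u x} = k"
    and common_adj: "E u v \<Longrightarrow> card {x. E u x \<and> E v x} = a"
    and common_nonadj: "u \<noteq> v \<Longrightarrow> \<not> E u v \<Longrightarrow> card {x. E u x \<and> E v x} = c"
    and c_pos: "c > 0" and a_less: "a + 1 < k"
    and even_spread: "fst x \<noteq> fst y \<Longrightarrow> \<not> E (fst x) (fst y) \<Longrightarrow> CARD('r) * common x y = c"
begin

lemma common_pos: "fst x \<noteq> fst y \<Longrightarrow> \<not> E (fst x) (fst y) \<Longrightarrow> common x y > 0"
  using even_spread[of x y] c_pos by (metis mult_0_right not_gr_zero)

lemma common_posE:
  assumes "common x y > 0"
  obtains z where "C x z" "C z y"
proof -
  have "{z. C x z \<and> C z y} \<noteq> {}" using assms unfolding common_def by (metis card.empty less_numeral_extra(3))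
  then show ?thesis using that by blast
qed

text \<open>Of the \<open>k\<close> neighbours of \<open>u\<close>, the vertex \<open>v\<close> and
  the \<open>a\<close> common neighbours are removed. The result is positive by
  \<open>a_less\<close>.\<close>

lemma card_far_neighbours:
  assumes "E u v"
  shows "card {w. E u w \<and> v \<noteq> w \<and> \<not> E v w} = k - 1 - a"
proof -
  have "{w. E u w \<and> v \<noteq> w \<and> \<not> E v w} = {w. E u w} - insert v {w. E u w \<and> E v w}"
    by blast
  moreover have "card (insert v {w. E u w \<and> E v w}) = Suc a"
    using assms E_irrefl by (simp add: common_adj)
  moreover have "insert v {w. E u w \<and> E v w} \<subseteq> {w. E u w}" using assms by blast
  ultimately show ?thesis by (simp add: card_Diff_subset valency)
qed

text \<open>\<open>D\<close> is the expected distance: 2 over a non-edge, 3 over an edge without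
  adjacency, 4 inside a fibre. Once \<open>gdist_eqI\<close> confirms it, the intersection numbers
  are counted through the projection.\<close>

lemma distance_regular_if:
  assumes no_common: "\<And>x y. E (fst x) (fst y) \<Longrightarrow> \<not> C x y \<Longrightarrow> common x y = 0"
  shows "distance_regular C"
proof -
  define D :: "'v \<times> 'r \<Rightarrow> 'v \<times> 'r \<Rightarrow> nat" where
    "D x y = (if x = y then 0 else if C x y then 1 else if fst x = fst y then 4
      else if E (fst x) (fst y) then 3 else 2)" for x y
  have irrefl: "\<not> C x x" for x using C_proj E_irrefl by blast
  have no_path: "\<not> C z y" if "E (fst x) (fst y)" "\<not> C x y" "C x z" for x y z
    using no_common[OF that(1,2)] that(3) unfolding common_def by (metis (mono_tags, lifting) card_0_eq empty_iff finite mem_Collect_eq)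
  have D0: "D x y = 0 \<longleftrightarrow> y = x" for x y by (auto simp: D_def)
  have D1: "D x y = Suc 0 \<longleftrightarrow> C x y" for x y using irrefl by (auto simp: D_def)
  have D2: "D x y = 2 \<longleftrightarrow> fst x \<noteq> fst y \<and> \<not> E (fst x) (fst y)" for x y
    using C_proj[of x y] by (auto simp: D_def)
  have D3: "D x y = 3 \<longleftrightarrow> E (fst x) (fst y) \<and> \<not> C x y" for x y
    using E_irrefl by (auto simp: D_def)
  have D4: "D x y = 4 \<longleftrightarrow> fst x = fst y \<and> x \<noteq> y" for x y
    using C_proj[of x y] E_irrefl by (auto simp: D_def)
  have Dle: "D x y \<le> 4" for x y by (simp add: D_def)
  \<comment> \<open>The jumps to exclude are from 1 to 3 (\<open>no_path\<close>), from 1 to 4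
    (unique lifts) and from 2 to 4 (projection to a non-edge).\<close>
  have step: "D x z \<le> Suc (D x y)" if "C y z" for x y z
  proof -
    consider "D x y = 0" | "D x y = 1" | "D x y = 2" | "D x y \<ge> 3" by linarith
    then show ?thesis
    proof cases
      case 1
      then show ?thesis using that by (simp add: D0 D1[symmetric])
    next
      case 2
      then have xy: "C x y" by (simp add: D1)
      have "D x z \<noteq> 3" using no_path[of x z y] xy that D3 by blast
      moreover have "D x z \<noteq> 4" using lift_unique[of y x z] xy C_sym that D4 by blast
      ultimately show ?thesis using Dle[of x z] 2 by linarith
    next
      case 3
      then have "\<not> E (fst x) (fst y)" by (simp add: D2)
      then have "D x z \<noteq> 4" using C_proj[OF that] E_sym D4 by metis
      then show ?thesis using Dle[of x z] 3 by linarith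
    next
      case 4
      then show ?thesis using Dle[of x z] by linarith
    qed
  qed
  \<comment> \<open>Supplies the predecessors of vertices at distance 3; this is where
    \<open>a + 1 < k\<close> matters.\<close>
  have far: "\<exists>z. C y z \<and> D x z = 2" if "E (fst y) (fst x)" for x y
  proof -
    have "{w. E (fst y) w \<and> fst x \<noteq> w \<and> \<not> E (fst x) w} \<noteq> {}"
      using card_far_neighbours[OF that] a_less by (metis card.empty diff_diff_left add.commute zero_less_diff less_numeral_extra(3))
    then obtain w where w: "E (fst y) w" "fst x \<noteq> w" "\<not> E (fst x) w" by blast
    then obtain j where "C y (w, j)" using C_lift by blast
    with w show ?thesis by (intro exI[of _ "(w, j)"]) (simp add: D2)
  qed
  have nbr: "\<exists>z. C y z" for y
  proof -
    have "{w. E (fst y) w} \<noteq> {}" using valency[of "fst y"] a_less by (metis card.empty not_less_zero)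
    then show ?thesis using C_lift by blast
  qed
  have pred: "\<exists>z. C z y \<and> D x z = m" if m: "D x y = Suc m" for x y m
  proof -
    consider "D x y = 1" | "D x y = 2" | "D x y = 3" | "D x y = 4" using m Dle[of x y] by linarith
    then show ?thesis
    proof cases
      case 1
      then show ?thesis using m D0[of x x] D1[of x y] by (intro exI[of _ x]) simp
    next
      case 2
      then obtain z where "C x z" "C z y" using common_posE common_pos D2 by metis
      then show ?thesis using m 2 D1[of x z] by (intro exI[of _ z]) simp
    next
      case 3
      then have "E (fst y) (fst x)" using D3 E_sym by blast
      then obtain z where "C y z" "D x z = 2" using far by blast
      then show ?thesis using m 3 C_sym by (intro exI[of _ z]) simp
    next
      case 4
      obtain z where z: "C y z" using nbr by blast
      have "\<not> C x z" using lift_unique[of z x y] 4 z C_sym D4 by blast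
      then have "D x z = 3" using 4 z C_proj D3 D4 by metis
      then show ?thesis using m 4 z C_sym by (intro exI[of _ z]) simp
    qed
  qed
  have dist: "gdist C x y = D x y" and conn: "C\<^sup>*\<^sup>* x y" for x y
    by (rule gdist_eqI[where D = "D x", OF D0 step pred]; assumption)+
  \<comment> \<open>The division of \<open>c\<close> is exact by \<open>even_spread\<close>.\<close>
  define b' where "b' = (\<lambda>d::nat. if d = 0 then k else if d = 1 then k - 1 - a
      else if d = 2 then c - c div CARD('r) else if d = 3 then 1 else 0)"
  define c' where "c' = (\<lambda>d::nat. if d = 0 then 0 else if d = 1 then 1
      else if d = 2 then c div CARD('r) else if d = 3 then k - 1 - a else k)"
  have "card {z. C y z \<and> D x z = D x y + 1} = b' (D x y) \<and> card {z. C y z \<and> D x z + 1 = D x y} = c' (D x y)" for x y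
  proof -
    consider "D x y = 0" | "D x y = 1" | "D x y = 2" | "D x y = 3" | "D x y = 4" using Dle[of x y] by linarith
    then show ?thesis
    proof cases
      case 1
      then have "y = x" by (simp add: D0)
      then have "{z. C y z \<and> D x z = D x y + 1} = {z. C y z \<and> True}" using 1 D1 by auto
      then show ?thesis using 1 card_lift[of y "\<lambda>_. True"] by (simp add: b'_def c'_def valency)
    next
      case 2
      then have xy: "C x y" by (simp add: D1)
      have "{z. C y z \<and> D x z = D x y + 1} = {z. C y z \<and> (fst x \<noteq> fst z \<and> \<not> E (fst x) (fst z))}"
        unfolding D2[symmetric] using 2 by (simp add: numeral_2_eq_2)
      moreover have "{z. C y z \<and> D x z + 1 = D x y} = {x}" using 2 D0 C_sym[OF xy] by auto
      ultimately show ?thesis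
        using 2 card_lift[of y "\<lambda>v. fst x \<noteq> v \<and> \<not> E (fst x) v"] card_far_neighbours E_sym C_proj[OF xy]
        by (simp add: b'_def c'_def)
    next
      case 3
      then have xy: "fst x \<noteq> fst y" "\<not> E (fst x) (fst y)" by (simp_all add: D2)
      have common: "common x y = c div CARD('r)"
        using even_spread[OF xy] by (metis nonzero_mult_div_cancel_left zero_less_card_finite less_numeral_extra(3))
      \<comment> \<open>The \<open>c\<close> neighbours of \<open>y\<close> lying over neighbours of
        \<open>fst x\<close> split into those adjacent to \<open>x\<close> (set \<open>?T\<close>)
        and those at distance 3.\<close>
      let ?S = "{z. C y z \<and> E (fst x) (fst z)}" and ?T = "{z. C x z \<and> C z y}"
      have "{z. C y z \<and> D x z = D x y + 1} = {z. C y z \<and> D x z = 3}" using 3 by simp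
      then have "{z. C y z \<and> D x z = D x y + 1} = ?S - ?T" unfolding D3 using C_sym by blast
      moreover have "?T \<subseteq> ?S" using C_sym C_proj by blast
      moreover have "card ?S = c"
        using card_lift[of y "E (fst x)"] common_nonadj[OF xy] by (simp add: conj_commute)
      moreover have "{z. C y z \<and> D x z + 1 = D x y} = {z. C y z \<and> D x z = Suc 0}" using 3 by auto
      then have "{z. C y z \<and> D x z + 1 = D x y} = ?T" unfolding D1 using C_sym by blast
      ultimately show ?thesis
        using 3 common by (simp add: b'_def c'_def common_def card_Diff_subset)
    next
      case 4
      then have xy: "E (fst x) (fst y)" "\<not> C x y" by (simp_all add: D3)
      have "{z. C y z \<and> D x z = D x y + 1} = {z. C y z \<and> D x z = 4}" using 4 by simp
      also have "\<dots> = {z. C y z \<and> fst z = fst x}"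
      proof -
        have "z \<noteq> x" if "C y z" for z using that xy(2) C_sym by blast
        then show ?thesis unfolding D4 by (intro Collect_cong) metis
      qed
      finally have "{z. C y z \<and> D x z = D x y + 1} = {z. C y z \<and> fst z = fst x}" .
      moreover have "{v. E (fst y) v \<and> v = fst x} = {fst x}" using xy E_sym by blast
      moreover have "{z. C y z \<and> D x z + 1 = D x y} = {z. C y z \<and> (fst x \<noteq> fst z \<and> \<not> E (fst x) (fst z))}"
        unfolding D2[symmetric] using 4 by auto
      ultimately show ?thesis
        using 4 card_lift[of y "\<lambda>v. v = fst x"] card_lift[of y "\<lambda>v. fst x \<noteq> v \<and> \<not> E (fst x) v"]
          card_far_neighbours E_sym[OF xy(1)]
        by (simp add: b'_def c'_def)
    next
      case 5
      then have xy: "fst x = fst y" "x \<noteq> y" by (simp_all add: D4)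
      have "{z. C y z \<and> D x z = D x y + 1} = {}"
      proof -
        have "D x z \<noteq> 5" for z using Dle[of x z] by linarith
        then show ?thesis using 5 by simp
      qed
      moreover have "D x z = 3" if "C y z" for z
      proof -
        have "\<not> C x z" using lift_unique[of z x y] xy that C_sym by blast
        then show ?thesis using C_proj[OF that] xy D3 by simp
      qed
      then have "{z. C y z \<and> D x z + 1 = D x y} = {z. C y z \<and> True}" using 5 by auto
      ultimately show ?thesis using 5 card_lift[of y "\<lambda>_. True"] by (simp add: b'_def c'_def valency)
    qed
  qed
  then have "\<exists>b c. \<forall>x y. card {z. C y z \<and> D x z = D x y + 1} = b (D x y) \<and>
      card {z. C y z \<and> D x z + 1 = D x y} = c (D x y)"
    by blast
  moreover have "simple_graph C"
    unfolding simple_graph_def using irrefl C_sym by (blast intro: sympI irreflpI)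
  moreover have "connected_graph C"
    unfolding connected_graph_def using conn by blast
  ultimately show ?thesis unfolding distance_regular_def dist by blast
qed

text \<open>Now any two non-adjacent vertices in distinct fibres are at distance 2. Seen from
  \<open>(u, i)\<close>, a vertex over an edge makes \<open>b 2\<close> non-zero, while
  \<open>(w, j)\<close> over a non-edge makes it 0.\<close>

lemma not_distance_regular_if:
  assumes pos: "\<And>x y. E (fst x) (fst y) \<Longrightarrow> \<not> C x y \<Longrightarrow> common x y > 0"
    and r: "CARD('r) \<ge> 2" and uw: "u \<noteq> w" "\<not> E u w"
  shows "\<not> distance_regular C"
proof
  assume "distance_regular C"
  then obtain b where b: "\<And>x y. card {z. C y z \<and> gdist C x z = gdist C x y + 1} = b (gdist C x y)"
    unfolding distance_regular_def by blast
  have irrefl: "\<not> C x x" for x using C_proj E_irrefl by blast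
  obtain i j :: 'r where ij: "i \<noteq> j"
    using r by (metis One_nat_def card_2_iff' card_le_Suc0_iff_eq finite UNIV_I numeral_2_eq_2 not_less_eq_eq)
  have d2: "gdist C x y = 2" if "fst x \<noteq> fst y" "\<not> C x y" for x y
  proof -
    have "common x y > 0" using pos common_pos that by blast
    then obtain z where "C x z" "C z y" by (rule common_posE)
    then show ?thesis using that by (intro gdist_eq_2) auto
  qed
  have d1: "gdist C x y = 1" if "C x y" for x y
    unfolding gdist_def
  proof (rule Least_equality)
    show "(C ^^ 1) x y" unfolding relpowp_1 by (rule that)
    show "1 \<le> m" if "(C ^^ m) x y" for m using that \<open>C x y\<close> irrefl by (cases m) auto
  qed

  have "{v. E u v} \<noteq> {}" using valency[of u] a_less by (metis card.empty not_less_zero)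
  then obtain v where uv: "E u v" by blast
  \<comment> \<open>The vertex is chosen next to \<open>(u, j)\<close> rather than
    \<open>(u, i)\<close>; unique lifts then make it non-adjacent to \<open>(u, i)\<close>.\<close>
  obtain l where l: "C (u, j) (v, l)" using C_lift[of "(u, j)" v] uv by auto
  let ?x = "(u, i)" and ?y = "(v, l)"
  have nxy: "\<not> C ?x ?y" using lift_unique[of ?y "(u, i)" "(u, j)"] l C_sym ij by auto
  have vu: "u \<noteq> v" using uv E_irrefl by blast
  have "common ?x ?y > 0" using pos uv nxy by simp
  then obtain z where z: "C ?x z" "C z ?y" by (rule common_posE)
  have "gdist C ?x (u, j) = 3"
  proof (rule gdist_eq_3[where z = z and w = ?y])
    show "\<not> C t (u, j)" if "C ?x t" for t using lift_unique[of t ?x "(u, j)"] that C_sym ij by auto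
    show "C ?y (u, j)" using l by (rule C_sym)
    show "\<not> C ?x (u, j)" using C_proj[of ?x "(u, j)"] E_irrefl by auto
  qed (use ij z in auto)
  moreover have "gdist C ?x ?y = 2" using d2 nxy vu by simp
  ultimately have "(u, j) \<in> {z. C ?y z \<and> gdist C ?x z = gdist C ?x ?y + 1}" using C_sym[OF l] by simp
  then have "{z. C ?y z \<and> gdist C ?x z = gdist C ?x ?y + 1} \<noteq> {}" by blast
  then have "card {z. C ?y z \<and> gdist C ?x z = gdist C ?x ?y + 1} \<noteq> 0"
    by (simp only: card_0_eq[OF finite] not_False_eq_True)
  then have "b (gdist C ?x ?y) \<noteq> 0" unfolding b .
  then have "b 2 \<noteq> 0" unfolding \<open>gdist C ?x ?y = 2\<close> .
  moreover have "b 2 = 0"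
  proof -
    have "gdist C ?x (w, j) = 2" using d2[of ?x "(w, j)"] uw C_proj[of ?x "(w, j)"] by auto
    \<comment> \<open>As \<open>u\<close> and \<open>w\<close> are not adjacent, \<open>t\<close>
      avoids the fibre of \<open>u\<close> and has distance 1 or 2.\<close>
    moreover have "gdist C ?x t \<noteq> 3" if "C (w, j) t" for t
    proof -
      have "fst ?x \<noteq> fst t" using C_proj[OF that] uw E_sym[of w u] by auto
      then show ?thesis using d1[of ?x t] d2[of ?x t] by (cases "C ?x t") auto
    qed
    then have "{t. C (w, j) t \<and> gdist C ?x t = 2 + 1} = {}" by auto
    then have "card {t. C (w, j) t \<and> gdist C ?x t = 2 + 1} = 0" by (simp only: card.empty)
    ultimately show ?thesis using b[of "(w, j)" ?x] by metis
  qed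
  ultimately show False by simp
qed

end

section \<open>Arc functions and representations of their group\<close>

lemma symmetric_arc_function_SomeE:
  assumes "subgroup G Sym" "symmetric_arc_function E G f" "E u v"
  obtains g where "f u v = Some g" "g \<in> Bij UNIV"
proof -
  obtain g where g: "f u v = Some g"
    using assms unfolding symmetric_arc_function_def by (metis not_None_eq)
  then have "g \<in> G" using assms unfolding symmetric_arc_function_def by blast
  then have "g \<in> carrier Sym" using assms(1) subgroup.subset by blast
  with g show ?thesis using that by (simp add: BijGroup_def)
qed

lemma symmetric_arc_function_inverse:
  assumes G: "subgroup G Sym" and f: "symmetric_arc_function E G f" and g: "f u v = Some g"
  obtains h where "f v u = Some h" "\<And>i. h (g i) = i"
proof -
  obtain h where h: "f v u = Some h" "g = inv\<^bsub>Sym\<^esub> h"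
    using f g unfolding symmetric_arc_function_def by blast
  have "E v u" using f h(1) unfolding symmetric_arc_function_def by (metis option.distinct(1))
  then have "h \<in> Bij UNIV" using symmetric_arc_function_SomeE[OF G f] h(1) by (metis option.inject)
  then have "bij h" "g = inv_into UNIV h" using h(2) by (auto simp: inv_BijGroup Bij_def fun_eq_iff)
  then show ?thesis using that h(1) by (simp add: bij_is_surj surj_f_inv_f)
qed

lemma cover_iff: "cover E f (v, j) (u, k) \<longleftrightarrow> E v u \<and> (\<exists>g. f u v = Some g \<and> g j = k)"
  by (simp add: cover_def)

text \<open>\<open>f v u\<close> carries labels of the fibre of \<open>u\<close> to labels of the
  fibre of \<open>v\<close>, so the edge from \<open>u\<close> to \<open>v\<close> lifts at
  \<open>(u, i)\<close> to \<open>(v, j)\<close> with \<open>j\<close> the image of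
  \<open>i\<close>.\<close>

lemma covering_cover:
  assumes "simple_graph E" and G: "subgroup G Sym" and f: "symmetric_arc_function E G f"
  shows "covering E (cover E f)"
proof
  have sym: "E u v \<Longrightarrow> E v u" for u v
    using assms(1) by (auto simp: simple_graph_def dest: sympD)
  show "E v u" if "E u v" for u v using sym that .
  show "\<not> E u u" for u using assms(1) by (auto simp: simple_graph_def irreflp_def)
  show "cover E f y x" if xy': "cover E f x y" for x y
  proof -
    obtain v j u k where xy: "x = (v, j)" "y = (u, k)" by (cases x; cases y) auto
    obtain g where g: "E v u" "f u v = Some g" "g j = k" using xy' by (auto simp: xy cover_iff)
    obtain h where "f v u = Some h" "\<And>i. h (g i) = i" using symmetric_arc_function_inverse[OF G f g(2)] by blast
    then show ?thesis using g sym by (auto simp: xy cover_iff)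
  qed
  show "E (fst x) (fst y)" if "cover E f x y" for x y
    using that by (cases x; cases y) (simp add: cover_iff)
  show "\<exists>!j. cover E f x (v, j)" if xv: "E (fst x) v" for x v
  proof -
    obtain u i where x: "x = (u, i)" by (cases x)
    obtain g where "f v u = Some g"
      using symmetric_arc_function_SomeE[OF G f sym] xv x by (metis fst_conv)
    then show ?thesis using xv by (auto simp: x cover_iff)
  qed
qed

lemma arc_group_carrier_Bij: "g \<in> carrier (arc_group f) \<Longrightarrow> g \<in> Bij UNIV"
proof -
  have "carrier (arc_group f) \<subseteq> carrier Sym"
    unfolding arc_group_def by (rule group.carrier_subgroup_generated_subset[OF group_BijGroup])
  then show "g \<in> carrier (arc_group f) \<Longrightarrow> g \<in> Bij UNIV" by (auto simp: BijGroup_def)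
qed

lemma arc_group_mult:
  "g \<in> carrier (arc_group f) \<Longrightarrow> h \<in> carrier (arc_group f) \<Longrightarrow> g \<otimes>\<^bsub>arc_group f\<^esub> h = g \<circ> h"
  using arc_group_carrier_Bij[of g f] arc_group_carrier_Bij[of h f]
  by (simp add: arc_group_def subgroup_generated_def BijGroup_def compose_def fun_eq_iff)

lemma group_arc_group: "group (arc_group f)"
  unfolding arc_group_def by (rule group.group_subgroup_generated[OF group_BijGroup])

lemma arc_group_comp:
  "g \<in> carrier (arc_group f) \<Longrightarrow> h \<in> carrier (arc_group f) \<Longrightarrow> g \<circ> h \<in> carrier (arc_group f)"
  using monoid.m_closed[OF group.is_monoid[OF group_arc_group]] arc_group_mult by metis

lemma arc_group_one: "\<one>\<^bsub>arc_group f\<^esub> = id"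
  by (simp add: arc_group_def subgroup_generated_def BijGroup_def fun_eq_iff)

lemma arc_group_id: "id \<in> carrier (arc_group f)"
  using monoid.one_closed[OF group.is_monoid[OF group_arc_group]] arc_group_one by metis

lemma arc_group_value:
  assumes "subgroup G Sym" "symmetric_arc_function E G f" "f u v = Some g"
  shows "g \<in> carrier (arc_group f)"
proof -
  have "g \<in> G" using assms unfolding symmetric_arc_function_def by blast
  then have "g \<in> carrier Sym" using assms(1) subgroup.subset by blast
  then show ?thesis
    using assms(3) unfolding arc_group_def carrier_subgroup_generated by (intro generate.incl) auto
qed

section \<open>Non-trivial irreducible representations of the arc group\<close>

locale arc_group_rep =
  fixes f :: "('v, 'r::finite) arc_fun" and \<phi> :: "('r \<Rightarrow> 'r) \<Rightarrow> complex^'d::finite^'d"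
  assumes irreducible: "irreducible_rep (arc_group f) \<phi>" and nontrivial: "nontrivial_rep (arc_group f) \<phi>"
begin

lemma rep_invertible: "g \<in> carrier (arc_group f) \<Longrightarrow> invertible (\<phi> g)"
  using irreducible unfolding irreducible_rep_def hom_def GL_def by auto

lemma rep_comp:
  assumes g: "g \<in> carrier (arc_group f)" and h: "h \<in> carrier (arc_group f)"
  shows "\<phi> (g \<circ> h) = \<phi> g ** \<phi> h"
proof -
  have "\<phi> (g \<otimes>\<^bsub>arc_group f\<^esub> h) = \<phi> g ** \<phi> h"
    using irreducible g h unfolding irreducible_rep_def hom_def GL_def by auto
  then show ?thesis unfolding arc_group_mult[OF g h] .
qed

lemma rep_id: "\<phi> id = mat 1"
proof -
  have "\<phi> id ** \<phi> id = \<phi> id" using rep_comp[OF arc_group_id arc_group_id] by simp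
  moreover obtain B where "B ** \<phi> id = mat 1"
    using rep_invertible[OF arc_group_id] unfolding invertible_def by blast
  ultimately show ?thesis by (metis matrix_mul_assoc matrix_mul_lid)
qed

text \<open>Left translation permutes the group, so the image of the sum consists of fixed vectors.
  These form an invariant subspace, proper since \<open>\<phi>\<close> is non-trivial, hence zero by
  irreducibility.\<close>

lemma rep_sum_zero: "(\<Sum>g\<in>carrier (arc_group f). \<phi> g) = 0"
proof -
  let ?H = "carrier (arc_group f)"
  let ?T = "\<Sum>g\<in>?H. \<phi> g"
  define W where "W = {w. \<forall>g\<in>?H. \<phi> g *v w = w}"
  have "vec.subspace W"
    by (simp add: W_def vec.subspace_def matrix_vector_right_distrib vector_scalar_commute)
  moreover have "\<forall>g\<in>?H. \<forall>w\<in>W. \<phi> g *v w \<in> W" by (simp add: W_def)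
  ultimately have "W = {0} \<or> W = UNIV"
    using irreducible unfolding irreducible_rep_def by blast
  moreover have "W \<noteq> UNIV"
  proof
    assume "W = UNIV"
    then have "\<phi> g *v w = mat 1 *v w" if "g \<in> ?H" for g w using that by (auto simp: W_def)
    then have "\<phi> g = mat 1" if "g \<in> ?H" for g using that by (simp add: matrix_eq)
    then show False using nontrivial unfolding nontrivial_rep_def by blast
  qed
  ultimately have W: "W = {0}" by blast
  have "\<phi> h ** ?T = ?T" if h: "h \<in> ?H" for h
  proof -
    have inj: "inj_on ((\<circ>) h) ?H"
      using arc_group_carrier_Bij[OF h] by (auto simp: inj_on_def fun_eq_iff Bij_def bij_betw_def)
    moreover have "(\<circ>) h ` ?H \<subseteq> ?H" using arc_group_comp[OF h] by blast
    ultimately have "(\<circ>) h ` ?H = ?H" by (simp add: endo_inj_surj)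
    then have "?T = (\<Sum>g\<in>?H. \<phi> (h \<circ> g))" using sum.reindex[OF inj, of \<phi>] by (simp add: comp_def)
    also have "\<dots> = (\<Sum>g\<in>?H. \<phi> h ** \<phi> g)" by (intro sum.cong refl rep_comp h)
    also have "\<dots> = \<phi> h ** ?T"
      by (simp add: vec_eq_iff matrix_matrix_mult_def sum_distrib_left sum.swap[of _ _ ?H])
    finally show ?thesis by simp
  qed
  then have "?T *v x \<in> W" for x by (simp add: W_def matrix_vector_mul_assoc)
  then have "?T *v x = 0" for x using W by blast
  then show ?thesis by (metis matrix_eq matrix_vector_mult_0)
qed

text \<open>On a single label the identity is the only map, and \<open>\<phi>\<close> would be
  trivial.\<close>

lemma card_fibre_ge_2: "CARD('r) \<ge> 2"
proof (rule ccontr)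
  assume "\<not> ?thesis"
  then have "CARD('r) \<le> Suc 0" by simp
  then have eq: "i = j" for i j :: 'r by (simp add: card_le_Suc0_iff_eq)
  have "g = id" for g :: "'r \<Rightarrow> 'r" using eq by blast
  then show False using nontrivial rep_id unfolding nontrivial_rep_def by metis
qed

end

lemma minimal_polynomial_quadratic:
  assumes "is_minimal_polynomial [:- mu, - lam, 1:] S"
  shows "(S ** S) $ p $ q = lam * S $ p $ q + mu * (if p = q then 1 else 0)"
proof -
  have *: "(mat x ** M) $ p $ q = x * M $ p $ q" for x and M :: "complex^'b^'b" and p q
    by (simp add: mat_def matrix_matrix_mult_def if_distrib[of "\<lambda>x. x * _"] cong: if_cong)
  have "matrix_poly [:- mu, - lam, 1:] S = 0"
    using assms by (simp add: is_minimal_polynomial_def)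
  then have "matrix_poly [:- mu, - lam, 1:] S $ p $ q = 0" by simp
  then show ?thesis
    by (simp add: matrix_poly_def numeral_2_eq_2 * ) (simp add: mat_def algebra_simps split: if_splits)
qed

text \<open>The block of \<open>S S\<close> at \<open>(u, w)\<close> sums \<open>\<phi>\<close> of
  \<open>f u v \<circ> f v w\<close> over the walks \<open>w, v, u\<close>. Lifted from
  \<open>(w, j)\<close>, those with value \<open>g\<close> are counted by
  \<open>common (w, j) (u, g j)\<close>, because regularity lets \<open>g j\<close> determine
  \<open>g\<close>.\<close>

lemma rep_matrix_square:
  fixes E :: "'v::finite \<Rightarrow> 'v \<Rightarrow> bool" and f :: "('v, 'r::finite) arc_fun" and \<phi> :: "('r \<Rightarrow> 'r) \<Rightarrow> complex^'d::finite^'d"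
  assumes "simple_graph E" and G: "subgroup G Sym" and f: "symmetric_arc_function E G f"
    and regular: "acts_regularly (arc_group f)"
    and "irreducible_rep (arc_group f) \<phi>" "nontrivial_rep (arc_group f) \<phi>"
    and formula: "\<And>x y. of_nat (covering.common (cover E f) x y) =
      s * (if cover E f x y then 1 else 0) + t * (if x = y then 1 else 0) + m (fst x) (fst y)"
  shows "(rep_matrix E f \<phi> ** rep_matrix E f \<phi>) $ p $ q = s * rep_matrix E f \<phi> $ p $ q + t * (if p = q then 1 else 0)"
proof -
  interpret covering E "cover E f" by (rule covering_cover) fact+
  interpret arc_group_rep f \<phi> by unfold_locales fact+
  let ?S = "rep_matrix E f \<phi>" and ?H = "carrier (arc_group f)"
  let ?f = "\<lambda>u v. the (f u v)"
  fix j :: 'r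
  obtain u \<alpha> w \<beta> where pq: "p = (u, \<alpha>)" "q = (w, \<beta>)" by (cases p; cases q) auto
  have S: "?S $ (u, \<alpha>) $ (v, \<beta>) = (if E u v then \<phi> (?f u v) $ \<alpha> $ \<beta> else 0)" for u v \<alpha> \<beta>
    by (simp add: rep_matrix_def adj_matrix_def)
  have some: "f u v = Some (?f u v)" if "E u v" for u v
    using symmetric_arc_function_SomeE[OF G f that] by (metis option.sel)
  have fH: "?f u v \<in> ?H" if "E u v" for u v
    using arc_group_value[OF G f some[OF that]] .
  have inj: "g = h" if "g \<in> ?H" "h \<in> ?H" "g j = h j" for g h
    using regular that unfolding acts_regularly_def by metis
  have C: "cover E f (v, i) (u, l) \<longleftrightarrow> E u v \<and> l = ?f u v i" for u v i l
    using some[of u v] E_sym by (auto simp: cover_iff)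
  define V where "V = {v. E u v \<and> E v w}"
  have "(?S ** ?S) $ p $ q = (\<Sum>v\<in>UNIV. \<Sum>\<gamma>\<in>UNIV. ?S $ (u, \<alpha>) $ (v, \<gamma>) * ?S $ (v, \<gamma>) $ (w, \<beta>))"
    by (simp add: pq matrix_matrix_mult_def sum_pair_UNIV)
  also have "\<dots> = (\<Sum>v\<in>UNIV. if v \<in> V then (\<phi> (?f u v) ** \<phi> (?f v w)) $ \<alpha> $ \<beta> else 0)"
    by (intro sum.cong refl) (auto simp: S V_def matrix_matrix_mult_def)
  also have "\<dots> = (\<Sum>v\<in>V. \<phi> (?f u v \<circ> ?f v w) $ \<alpha> $ \<beta>)"
    by (simp add: sum.If_cases) (simp add: V_def fH rep_comp)
  also have "\<dots> = (\<Sum>g\<in>?H. \<Sum>v | v \<in> V \<and> ?f u v \<circ> ?f v w = g. \<phi> (?f u v \<circ> ?f v w) $ \<alpha> $ \<beta>)"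
    by (rule sum.group[symmetric]) (auto simp: V_def fH arc_group_comp)
  also have "\<dots> = (\<Sum>g\<in>?H. of_nat (common (w, j) (u, g j)) * \<phi> g $ \<alpha> $ \<beta>)"
  proof (rule sum.cong)
    fix g assume g: "g \<in> ?H"
    have "bij_betw (\<lambda>v. (v, ?f v w j)) {v. v \<in> V \<and> ?f u v \<circ> ?f v w = g}
        {z. cover E f (w, j) z \<and> cover E f z (u, g j)}"
    proof (rule bij_betwI')
      fix v assume "v \<in> {v. v \<in> V \<and> ?f u v \<circ> ?f v w = g}"
      then show "(v, ?f v w j) \<in> {z. cover E f (w, j) z \<and> cover E f z (u, g j)}"
        by (auto simp: C V_def)
    next
      fix z assume "z \<in> {z. cover E f (w, j) z \<and> cover E f z (u, g j)}"
      then obtain v where v: "z = (v, ?f v w j)" "E v w" "E u v" "g j = (?f u v \<circ> ?f v w) j"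
        by (cases z) (auto simp: C)
      then have "?f u v \<circ> ?f v w = g"
        using inj[OF g arc_group_comp[OF fH[OF v(3)] fH[OF v(2)]]] by simp
      then show "\<exists>v\<in>{v. v \<in> V \<and> ?f u v \<circ> ?f v w = g}. z = (v, ?f v w j)" using v by (auto simp: V_def)
    qed auto
    then have "card {v. v \<in> V \<and> ?f u v \<circ> ?f v w = g} = common (w, j) (u, g j)"
      unfolding common_def by (rule bij_betw_same_card)
    then show "(\<Sum>v | v \<in> V \<and> ?f u v \<circ> ?f v w = g. \<phi> (?f u v \<circ> ?f v w) $ \<alpha> $ \<beta>) =
        of_nat (common (w, j) (u, g j)) * \<phi> g $ \<alpha> $ \<beta>"
      by simp
  qed simp
  \<comment> \<open>The terms become \<open>S\<close>, the identity and a multiple of the sum of all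
    \<open>\<phi> g\<close>; \<open>m\<close> depends on the fibres alone and leaves the
    sum.\<close>
  also have "\<dots> = s * (\<Sum>g\<in>?H. if cover E f (w, j) (u, g j) then \<phi> g $ \<alpha> $ \<beta> else 0)
      + t * (\<Sum>g\<in>?H. if (w, j) = (u, g j) then \<phi> g $ \<alpha> $ \<beta> else 0) + m w u * (\<Sum>g\<in>?H. \<phi> g) $ \<alpha> $ \<beta>"
    unfolding formula sum_component sum_distrib_left sum.distrib[symmetric]
    by (intro sum.cong refl) (auto simp: algebra_simps)
  also have "(\<Sum>g\<in>?H. if cover E f (w, j) (u, g j) then \<phi> g $ \<alpha> $ \<beta> else 0) = ?S $ p $ q"
  proof (cases "E u w")
    case True
    then have "cover E f (w, j) (u, g j) \<longleftrightarrow> g = ?f u w" if "g \<in> ?H" for g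
      using inj[OF that fH[OF True]] by (auto simp: C)
    then have "(\<Sum>g\<in>?H. if cover E f (w, j) (u, g j) then \<phi> g $ \<alpha> $ \<beta> else 0)
        = (\<Sum>g\<in>?H. if g = ?f u w then \<phi> g $ \<alpha> $ \<beta> else 0)"
      by (intro sum.cong refl) simp
    then show ?thesis using True fH[OF True] by (simp add: pq S)
  qed (simp add: C pq S)
  also have "(\<Sum>g\<in>?H. if (w, j) = (u, g j) then \<phi> g $ \<alpha> $ \<beta> else 0) = (if p = q then 1 else 0)"
  proof (cases "u = w")
    case True
    have "(w, j) = (u, g j) \<longleftrightarrow> g = id" if "g \<in> ?H" for g
      using inj[OF that arc_group_id] True by auto
    then have "(\<Sum>g\<in>?H. if (w, j) = (u, g j) then \<phi> g $ \<alpha> $ \<beta> else 0)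
        = (\<Sum>g\<in>?H. if g = id then \<phi> g $ \<alpha> $ \<beta> else 0)"
      by (intro sum.cong refl) simp
    then show ?thesis using True by (simp add: pq rep_id arc_group_id) (simp add: mat_def)
  qed (simp add: pq)
  finally show ?thesis by (simp add: rep_sum_zero)
qed

text \<open>The diameter is an attained maximum. The induced path obtained yields
  \<open>c > 0\<close>, \<open>a + 1 < k\<close> and a non-edge in the main proof.\<close>

lemma strongly_regular_distance_2:
  assumes "strongly_regular E n k a c"
  obtains x y z where "E x z" "E z y" "x \<noteq> y" "\<not> E x y"
proof -
  have dr: "distance_regular E" and diam: "gdiameter E = 2"
    using assms by (simp_all add: strongly_regular_def)
  have "2 \<in> range (\<lambda>(u, v). gdist E u v)"
    unfolding diam[symmetric] gdiameter_def by (rule Max_in) auto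
  then obtain x y where xy: "gdist E x y = 2" by auto
  have "E\<^sup>*\<^sup>* x y" using dr by (simp add: distance_regular_def connected_graph_def)
  \<comment> \<open>Some walk must exist before the \<open>LEAST\<close> in \<open>gdist\<close> is
    known to be the length of a walk.\<close>
  then obtain l where "(E ^^ l) x y" using rtranclp_imp_relpowp by metis
  then have "(E ^^ 2) x y" using xy unfolding gdist_def by (metis LeastI)
  then obtain z where z: "E x z" "E z y" by (auto simp: numeral_2_eq_2)
  have least: "\<not> (E ^^ l) x y" if "l < 2" for l
    using that xy not_less_Least[of l "\<lambda>l. (E ^^ l) x y"] by (simp add: gdist_def)
  have "x \<noteq> y" using least[of 0] by simp
  moreover have "\<not> E x y" using least[of 1] by (metis one_less_numeral_iff relpowp_1 semiring_norm(76))
  ultimately show ?thesis using z that by blast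
qed

theorem theorem6p3:
  fixes E :: "'v::finite \<Rightarrow> 'v \<Rightarrow> bool"
    and G :: "('r::finite \<Rightarrow> 'r) set"
    and f :: "('v, 'r) arc_fun"
    and \<phi> :: "('r \<Rightarrow> 'r) \<Rightarrow> complex^'d::finite^'d"
    and n k a c :: nat
    and lam mu :: complex
  assumes "simple_graph E" and "connected_graph E"
    and "strongly_regular E n k a c"
    and "subgroup G Sym"
    and "symmetric_arc_function E G f"
    and "normalized E f"
    and "acts_regularly (arc_group f)"
    and "cyclic_group (arc_group f)"
    and "two_ev_cover E f"
    and "irreducible_rep (arc_group f) \<phi>"
    and "nontrivial_rep (arc_group f) \<phi>"
    and "is_minimal_polynomial [:- mu, - lam, 1:] (rep_matrix E f \<phi>)"
  shows "distance_regular (cover E f) \<longleftrightarrow> of_nat a = lam"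
proof -
  let ?C = "cover E f" and ?S = "rep_matrix E f \<phi>"
  let ?r = "of_nat CARD('r) :: complex"
  interpret covering E ?C by (rule covering_cover) fact+
  interpret arc_group_rep f \<phi> by unfold_locales fact+
  note r = card_fibre_ge_2
  have valency: "card {x. E u x} = k" for u
    using assms(3) by (simp add: strongly_regular_def)
  have adj: "E u v \<Longrightarrow> card {x. E u x \<and> E v x} = a" for u v
    using assms(3) by (simp add: strongly_regular_def)
  have nonadj: "u \<noteq> v \<Longrightarrow> \<not> E u v \<Longrightarrow> card {x. E u x \<and> E v x} = c" for u v
    using assms(3) by (simp add: strongly_regular_def)
  obtain x0 z0 y0 where xyz: "E x0 z0" "E z0 y0" "x0 \<noteq> y0" "\<not> E x0 y0"
    using strongly_regular_distance_2[OF assms(3)] by metis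
  have swap: "{v. E u v \<and> E v w} = {v. E u v \<and> E w v}" for u w using E_sym by blast
  obtain s where formula: "\<And>x y. ?r * (of_nat (common x y) - s * (if ?C x y then 1 else 0) - of_nat k * (if x = y then 1 else 0)) =
     of_nat (card {v. E (fst x) v \<and> E v (fst y)}) - s * (if E (fst x) (fst y) then 1 else 0) - (of_nat k * (if fst x = fst y then 1 else 0) :: complex)"
    using common_formula[OF assms(9)[unfolded two_ev_cover_def] r valency] by blast
  have r0: "?r \<noteq> 0" by simp
  \<comment> \<open>The fibre-constant part of the common neighbour count.\<close>
  define m where "m u w = (of_nat (card {v. E u v \<and> E v w}) - s * (if E u w then 1 else 0)
      - of_nat k * (if u = w then 1 else 0)) / ?r" for u w
  have formula': "of_nat (common x y) = s * (if ?C x y then 1 else 0) + of_nat k * (if x = y then 1 else 0)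
      + m (fst x) (fst y)" for x y
  proof -
    have "a' = b' + d' + M / ?r" if "?r * (a' - b' - d') = M" for a' b' d' M
      using that r0 by (auto simp: field_simps)
    then show ?thesis unfolding m_def using formula[of x y] by blast
  qed

  have entries: "lam * ?S $ p $ q + mu * (if p = q then 1 else 0) = s * ?S $ p $ q + of_nat k * (if p = q then 1 else 0)" for p q
    using minimal_polynomial_quadratic[OF assms(12), of p q]
      rep_matrix_square[OF assms(1,4,5,7,10,11) formula', of p q] by simp
  \<comment> \<open>Both quadratic expressions for \<open>S S\<close> are compared at a non-zero
    entry of the block \<open>(x0, z0)\<close>, off the diagonal; one exists since
    \<open>\<phi> g\<close> is invertible.\<close>
  have lam: "lam = s"
  proof -
    define g where "g = the (f x0 z0)"
    have "f x0 z0 = Some g"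
      using symmetric_arc_function_SomeE[OF assms(4,5) xyz(1)] unfolding g_def by (metis option.sel)
    then have "invertible (\<phi> g)"
      using arc_group_value[OF assms(4,5)] rep_invertible by blast
    then obtain B where B: "\<phi> g ** B = mat 1" unfolding invertible_def by blast
    have "\<phi> g \<noteq> 0"
    proof
      assume "\<phi> g = 0"
      then have "\<phi> g ** B = 0" by (simp add: vec_eq_iff matrix_matrix_mult_def)
      then have "(mat 1 :: complex^'d^'d) $ \<alpha> $ \<alpha> = 0" for \<alpha> using B by simp
      then show False by (simp add: mat_def)
    qed
    then obtain \<alpha> \<beta> where "\<phi> g $ \<alpha> $ \<beta> \<noteq> 0" by (auto simp: vec_eq_iff)
    then have "?S $ (x0, \<alpha>) $ (z0, \<beta>) \<noteq> 0"
      using xyz(1) by (simp add: rep_matrix_def adj_matrix_def g_def)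
    moreover have "x0 \<noteq> z0" using xyz(1) E_irrefl by blast
    ultimately show ?thesis using entries[of "(x0, \<alpha>)" "(z0, \<beta>)"] by simp
  qed

  interpret srg_covering E ?C k a c
  proof
    show "card {x. E u x} = k" for u by (rule valency)
    show "card {x. E u x \<and> E v x} = a" if "E u v" for u v using that by (rule adj)
    show "card {x. E u x \<and> E v x} = c" if "u \<noteq> v" "\<not> E u v" for u v using that by (rule nonadj)
    have "z0 \<in> {x. E x0 x \<and> E y0 x}" using xyz E_sym by blast
    then show "c > 0" using nonadj[OF xyz(3,4)] by (metis card_gt_0_iff empty_iff finite)
    \<comment> \<open>The neighbours of \<open>z0\<close> include \<open>x0\<close>,
      \<open>y0\<close> and its \<open>a\<close> common neighbours with \<open>x0\<close>. As
      \<open>y0\<close> is not adjacent to \<open>x0\<close>, these are \<open>a + 2\<close>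
      vertices.\<close>
    have "insert x0 (insert y0 {x. E z0 x \<and> E x0 x}) \<subseteq> {x. E z0 x}" using xyz E_sym by blast
    then have "card (insert x0 (insert y0 {x. E z0 x \<and> E x0 x})) \<le> k"
      using valency[of z0] by (metis card_mono finite)
    then show "a + 1 < k" using xyz E_irrefl adj[OF E_sym[OF xyz(1)]] by simp
    show "CARD('r) * common x y = c" if "fst x \<noteq> fst y" "\<not> E (fst x) (fst y)" for x y
    proof -
      have "\<not> ?C x y" "x \<noteq> y" using that C_proj[of x y] by auto
      then have "?r * of_nat (common x y) = of_nat c"
        using formula[of x y] that nonadj by (simp add: swap)
      then show ?thesis by (metis of_nat_eq_iff of_nat_mult)
    qed
  qed

  \<comment> \<open>The number of common neighbours of non-adjacent vertices over an edge is zero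
    exactly if \<open>a = s\<close>, which settles both directions.\<close>
  have common_edge: "?r * of_nat (common x y) = of_nat a - s" if "E (fst x) (fst y)" "\<not> ?C x y" for x y
  proof -
    have "fst x \<noteq> fst y" "x \<noteq> y" using that E_irrefl by auto
    then show ?thesis using formula[of x y] that adj by (simp add: swap)
  qed
  show ?thesis
  proof
    assume "of_nat a = lam"
    show "distance_regular ?C"
    proof (rule distance_regular_if)
      show "common x y = 0" if "E (fst x) (fst y)" "\<not> ?C x y" for x y
        using common_edge[OF that] \<open>of_nat a = lam\<close> lam by simp
    qed
  next
    assume dr: "distance_regular ?C"
    show "of_nat a = lam"
    proof (rule ccontr)
      assume "of_nat a \<noteq> lam"
      then have "common x y > 0" if "E (fst x) (fst y)" "\<not> ?C x y" for x y
        using common_edge[OF that] lam by (cases "common x y = 0") auto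
      then show False using not_distance_regular_if[OF _ r xyz(3,4)] dr by blast
    qed
  qed
qed

end
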